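(* For any (fixed) integer $\ell\geq 0$, enumerating all maximal independent sets of a given graph can be done in polynomial time for graphs in the class of $(1,\ell)$-graphs.
   Context: Graphs are finite, simple and undirected. For integers $k,\ell\ge 0$, a $(k,\ell)$-graph is a graph whose vertex set can be partitioned into $k$ independent sets and $\ell$ cliques, where parts are allowed to be empty (and a single vertex may be counted either as an independent set or as a clique); such a partition is a $(k,\ell)$-partition. A maximal independent set is an independent set not properly contained in another independent set. The input is the graph alone; no $(1,\ell)$-partition is given. *)

theory Defs
  imports "HOL-Library.Ramsey" "HOL-Library.Disjoint_Sets"
    "HOL-Computational_Algebra.Polynomial"
begin

section \<open>Graphs and their maximal independent sets\<close>

definition simple_graph :: "'a set \<Rightarrow> 'a set set \<Rightarrow> bool" where
  "simple_graph V E \<longleftrightarrow> finite V \<and> E \<subseteq> nsets V 2"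

definition kl_partition ::
  "nat \<Rightarrow> nat \<Rightarrow> 'a set \<Rightarrow> 'a set set \<Rightarrow> (nat \<Rightarrow> 'a set) \<Rightarrow> (nat \<Rightarrow> 'a set) \<Rightarrow> bool" where
  "kl_partition k l V E S K \<longleftrightarrow>
     (\<Union>i<k. S i) \<union> (\<Union>j<l. K j) = V \<and>
     disjoint_family_on S {..<k} \<and> disjoint_family_on K {..<l} \<and>
     (\<Union>i<k. S i) \<inter> (\<Union>j<l. K j) = {} \<and>
     (\<forall>i<k. indep (S i) E) \<and> (\<forall>j<l. clique (K j) E)"

definition kl_graph :: "nat \<Rightarrow> nat \<Rightarrow> 'a set \<Rightarrow> 'a set set \<Rightarrow> bool" where
  "kl_graph k l V E \<longleftrightarrow> simple_graph V E \<and> (\<exists>S K. kl_partition k l V E S K)"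

definition maximal_indep :: "'a set \<Rightarrow> 'a set set \<Rightarrow> 'a set \<Rightarrow> bool" where
  "maximal_indep V E I \<longleftrightarrow>
     I \<subseteq> V \<and> indep I E \<and> \<not> (\<exists>J. J \<subseteq> V \<and> indep J E \<and> I \<subset> J)"


section \<open>Random access machine\<close>

text \<open>
  The machine is the unit-cost RAM of Cook and Reckhow with structured control flow: registers
  and memory cells hold natural numbers, the arithmetic operations are addition and truncated
  subtraction, and memory is addressed indirectly through registers. There is no multiplication,
  so a run of \<open>t\<close> steps only creates numbers whose bit length exceeds that of the input numbers
  and of the constants in the program by at most \<open>t\<close>; hence polynomial time on this machine is
  polynomial time on Turing machines.
  Arguments of instructions are register names, except for the constant in \<open>SET\<close>.
  The output is an append-only tape.
\<close>

datatype instr =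
    SET nat nat
  | ADD nat nat nat
  | SUB nat nat nat
  | LOAD nat nat
  | STORE nat nat
  | OUT nat

datatype prog =
    Instr instr
  | Seq prog prog
  | Cond nat prog prog
  | Loop nat prog

record state =
  reg :: "nat \<Rightarrow> nat"
  mem :: "nat \<Rightarrow> nat"
  out :: "nat list"

fun exec :: "instr \<Rightarrow> state \<Rightarrow> state" where
  "exec (SET r k) s = s\<lparr>reg := (reg s)(r := k)\<rparr>"
| "exec (ADD r a b) s = s\<lparr>reg := (reg s)(r := reg s a + reg s b)\<rparr>"
| "exec (SUB r a b) s = s\<lparr>reg := (reg s)(r := reg s a - reg s b)\<rparr>"
| "exec (LOAD r a) s = s\<lparr>reg := (reg s)(r := mem s (reg s a))\<rparr>"
| "exec (STORE a r) s = s\<lparr>mem := (mem s)(reg s a := reg s r)\<rparr>"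
| "exec (OUT r) s = s\<lparr>out := out s @ [reg s r]\<rparr>"

text \<open>\<open>steps c s t s'\<close>: started in \<open>s\<close>, program \<open>c\<close> halts in \<open>s'\<close> after exactly \<open>t\<close>
  executed instructions and register tests. A test succeeds on nonzero values.\<close>

inductive steps :: "prog \<Rightarrow> state \<Rightarrow> nat \<Rightarrow> state \<Rightarrow> bool" where
  Instr: "steps (Instr i) s 1 (exec i s)"
| Seq: "\<lbrakk>steps c s t s'; steps d s' u s''\<rbrakk> \<Longrightarrow> steps (Seq c d) s (t + u) s''"
| CondT: "\<lbrakk>reg s r \<noteq> 0; steps c s t s'\<rbrakk> \<Longrightarrow> steps (Cond r c d) s (1 + t) s'"
| CondF: "\<lbrakk>reg s r = 0; steps d s t s'\<rbrakk> \<Longrightarrow> steps (Cond r c d) s (1 + t) s'"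
| LoopT: "\<lbrakk>reg s r \<noteq> 0; steps c s t s'; steps (Loop r c) s' u s''\<rbrakk>
    \<Longrightarrow> steps (Loop r c) s (1 + t + u) s''"
| LoopF: "reg s r = 0 \<Longrightarrow> steps (Loop r c) s 1 s"

inductive_cases steps_InstrE: "steps (Instr i) s t s'"
inductive_cases steps_SeqE: "steps (Seq c d) s t s'"
inductive_cases steps_CondE: "steps (Cond r c d) s t s'"
inductive_cases steps_LoopE: "steps (Loop r c) s t s'"

lemma steps_deterministic:
  "steps c s t s' \<Longrightarrow> steps c s u s'' \<Longrightarrow> t = u \<and> s' = s''"
proof (induction arbitrary: u s'' rule: steps.induct)
  case (Instr i s)
  then show ?case by (auto elim: steps_InstrE)
next
  case (Seq c s t s' d v s1)
  from Seq.prems obtain t' v' s2 where *: "u = t' + v'" "steps c s t' s2" "steps d s2 v' s''"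
    by (rule steps_SeqE)
  with Seq.IH(1) have "t = t'" "s' = s2" by auto
  with * Seq.IH(2) show ?case by auto
next
  case (CondT s r c t s' d)
  from CondT.prems CondT.hyps obtain t' where *: "u = 1 + t'" "steps c s t' s''"
    by (auto elim: steps_CondE)
  with CondT.IH show ?case by auto
next
  case (CondF s r d t s' c)
  from CondF.prems CondF.hyps obtain t' where *: "u = 1 + t'" "steps d s t' s''"
    by (auto elim: steps_CondE)
  with CondF.IH show ?case by auto
next
  case (LoopT s r c t s' v s1)
  from LoopT.prems LoopT.hyps(1) obtain t' v' s2
    where *: "u = 1 + t' + v'" "steps c s t' s2" "steps (Loop r c) s2 v' s''"
    by (auto elim: steps_LoopE)
  with LoopT.IH(1) have "t = t'" "s' = s2" by auto
  with * LoopT.IH(2) show ?case by auto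
next
  case (LoopF s r c)
  then show ?case by (auto elim: steps_LoopE)
qed

definition start_state :: "nat list \<Rightarrow> state" where
  "start_state xs =
     \<lparr>reg = (\<lambda>_. 0), mem = (\<lambda>a. if a < length xs then xs ! a else 0), out = []\<rparr>"

text \<open>\<open>runs c xs t ys\<close>: on input \<open>xs\<close>, program \<open>c\<close> halts after \<open>t\<close> steps with output \<open>ys\<close>.\<close>

definition runs :: "prog \<Rightarrow> nat list \<Rightarrow> nat \<Rightarrow> nat list \<Rightarrow> bool" where
  "runs c xs t ys \<longleftrightarrow> (\<exists>s. steps c (start_state xs) t s \<and> out s = ys)"


section \<open>Input and output format\<close>

text \<open>A graph on \<open>{..<n}\<close> is given by \<open>n\<close> followed by the rows of its adjacency matrix.\<close>

definition graph_input :: "nat \<Rightarrow> nat set set \<Rightarrow> nat list" where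
  "graph_input n E = n # [if {i, j} \<in> E then 1 else 0. i \<leftarrow> [0..<n], j \<leftarrow> [0..<n]]"

text \<open>Vertices are written shifted by one, so that 0 can mark the end of a set and a
  sequence of sets (including empty ones) can be read off the output uniquely.\<close>

definition encode_set :: "nat set \<Rightarrow> nat list" where
  "encode_set I = map Suc (sorted_list_of_set I) @ [0]"

end

theory Submission
  imports Defs
begin

text \<open>
  A \<open>(1, l)\<close>-graph on \<open>n\<close> vertices has at most \<open>(n + 1) ^ l\<close> maximal independent sets: such a set
  meets each clique in at most one vertex, and its part in the independent class consists of the
  vertices there without neighbours in the cliques' part. Induced subgraphs are again
  \<open>(1, l)\<close>-graphs, so it suffices to enumerate in time polynomial in \<open>n\<close> and the number of
  maximal independent sets of the subgraphs induced on the prefixes \<open>{..<i}\<close>; no partition has to be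
  known. Following Tsukiyama, Ide, Ariyoshi and Shirakawa, a maximal independent set of the prefix
  \<open>{..<i + 1}\<close> gets as its parent the set itself if it omits \<open>i\<close>, and otherwise the greedy
  completion within \<open>{..<i}\<close> of what remains after deleting \<open>i\<close>. This is a tree whose nodes at
  depth \<open>i\<close> are the maximal independent sets of the \<open>i\<close>-th prefix, each occurring once, and whose
  children are computable in polynomial time. The machine traverses it depth first with a stack.
\<close>

section \<open>The tree of maximal independent sets of the prefixes\<close>

locale fin_graph =
  fixes n :: nat and E :: "nat set set"
  assumes edges: "E \<subseteq> nsets {..<n} 2"
begin

definition adj :: "nat \<Rightarrow> nat \<Rightarrow> bool" where
  "adj u w \<longleftrightarrow> {u, w} \<in> E"

lemma adj_sym: "adj u w \<longleftrightarrow> adj w u"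
  by (simp add: adj_def insert_commute)

lemma adj_irrefl [simp]: "\<not> adj u u"
  using edges by (auto simp: adj_def nsets_def)

lemma adj_less: "adj u w \<Longrightarrow> u < n" "adj u w \<Longrightarrow> w < n"
  using edges by (auto simp: adj_def nsets_def)

definition stable :: "nat set \<Rightarrow> bool" where
  "stable I \<longleftrightarrow> (\<forall>u\<in>I. \<forall>w\<in>I. \<not> adj u w)"

text \<open>Maximality as domination: a stable set is maximal exactly when each vertex outside it
  has a neighbour in it.\<close>

definition prefix_mis :: "nat \<Rightarrow> nat set \<Rightarrow> bool" where
  "prefix_mis i I \<longleftrightarrow> I \<subseteq> {..<i} \<and> stable I \<and> (\<forall>u<i. u \<notin> I \<longrightarrow> (\<exists>w\<in>I. adj u w))"

lemma indep_iff_stable: "indep I E \<longleftrightarrow> stable I"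
  unfolding indep_def stable_def adj_def[symmetric] by (metis adj_irrefl)

lemma maximal_indep_iff: "maximal_indep {..<n} E I \<longleftrightarrow> prefix_mis n I"
proof
  assume I: "maximal_indep {..<n} E I"
  have "\<exists>w\<in>I. adj u w" if "u < n" "u \<notin> I" for u
  proof (rule ccontr)
    assume no: "\<not> (\<exists>w\<in>I. adj u w)"
    have "stable (insert u I)"
      using I no by (auto simp: maximal_indep_def indep_iff_stable stable_def adj_sym)
    with I that show False
      unfolding maximal_indep_def indep_iff_stable by blast
  qed
  with I show "prefix_mis n I"
    by (auto simp: prefix_mis_def maximal_indep_def indep_iff_stable)
next
  assume "prefix_mis n I"
  then show "maximal_indep {..<n} E I"
    unfolding prefix_mis_def maximal_indep_def indep_iff_stable stable_def by blast
qed

section \<open>Parents and children between consecutive prefixes\<close>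

definition has_nbr :: "nat \<Rightarrow> nat set \<Rightarrow> bool" where
  "has_nbr i I \<longleftrightarrow> (\<exists>w\<in>I. adj i w)"

definition swap :: "nat \<Rightarrow> nat set \<Rightarrow> nat set" where
  "swap i I = insert i {w \<in> I. \<not> adj i w}"

text \<open>
  States at once that \<open>swap i I\<close> is maximal in the prefix \<open>{..<Suc i}\<close> (vertices \<open>u\<close> not adjacent to
  \<open>i\<close>) and that \<open>I\<close> is the greedy completion of \<open>swap i I - {i}\<close> (vertices \<open>u\<close> adjacent to \<open>i\<close>).
\<close>

definition canonical :: "nat \<Rightarrow> nat set \<Rightarrow> bool" where
  "canonical i I \<longleftrightarrow>
     (\<forall>u<i. u \<notin> I \<longrightarrow> (\<exists>w\<in>I. adj u w \<and> (\<not> adj i w \<or> (w < u \<and> adj i u))))"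

text \<open>A list, so that the order of traversal is fixed: the child containing \<open>i\<close>
  comes first. Without a neighbour of \<open>i\<close>, the set \<open>I\<close> itself would not be
  maximal in the longer prefix.\<close>

definition children :: "nat \<Rightarrow> nat set \<Rightarrow> nat set list" where
  "children i I =
     (if canonical i I then [swap i I] else []) @ (if has_nbr i I then [I] else [])"

text \<open>In \<open>swap i I\<close> the neighbours of \<open>i\<close> are dominated by
  \<open>i\<close>; for the other vertices \<open>canonical\<close> supplies a neighbour that
  survives the deletion.\<close>

lemma children_prefix_mis:
  assumes I: "prefix_mis i I" and X: "X \<in> set (children i I)"
  shows "prefix_mis (Suc i) X"
proof -
  consider "has_nbr i I" "X = I" | "canonical i I" "X = swap i I"
    using X by (auto simp: children_def split: if_splits)
  then show ?thesis
  proof cases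
    case 1
    then show ?thesis
      using I by (auto simp: prefix_mis_def has_nbr_def less_Suc_eq)
  next
    case 2
    have "\<exists>w\<in>X. adj u w" if "u < Suc i" "u \<notin> X" for u
    proof (cases "adj i u")
      case True
      then show ?thesis using 2 by (auto simp: swap_def adj_sym)
    next
      case False
      with that 2 have "u < i" "u \<notin> I" by (auto simp: swap_def)
      with 2 False show ?thesis by (auto simp: swap_def canonical_def)
    qed
    then show ?thesis
      using I 2 by (auto simp: prefix_mis_def swap_def stable_def adj_sym less_Suc_eq)
  qed
qed

text \<open>Scan the vertices in increasing order and add each one without a neighbour in the set so
  far. What blocks a skipped vertex is in \<open>J\<close> or was added earlier and hence is
  smaller.\<close>

lemma greedy_completion:
  assumes J: "J \<subseteq> {..<i}" "stable J" and "m \<le> i"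
  shows "\<exists>I. J \<subseteq> I \<and> I \<subseteq> {..<m} \<union> J \<and> stable I \<and>
    (\<forall>u<m. u \<notin> I \<longrightarrow> (\<exists>w\<in>I. adj u w \<and> (w \<in> J \<or> w < u)))"
  using \<open>m \<le> i\<close>
proof (induction m)
  case 0
  then show ?case using J by (intro exI[of _ J]) auto
next
  case (Suc m)
  then obtain I where I: "J \<subseteq> I" "I \<subseteq> {..<m} \<union> J" "stable I"
    "\<forall>u<m. u \<notin> I \<longrightarrow> (\<exists>w\<in>I. adj u w \<and> (w \<in> J \<or> w < u))"
    by auto
  show ?case
  proof (cases "m \<in> I \<or> (\<exists>w\<in>I. adj m w)")
    case True
    with I show ?thesis
      by (intro exI[of _ I]) (fastforce simp: less_Suc_eq)
  next
    case False
    with I have "stable (insert m I)" by (auto simp: stable_def adj_sym)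
    with I show ?thesis
      by (intro exI[of _ "insert m I"]) (fastforce simp: less_Suc_eq)
  qed
qed

lemma prefix_mis_has_parent:
  assumes X: "prefix_mis (Suc i) X"
  shows "\<exists>I. prefix_mis i I \<and> X \<in> set (children i I)"
proof (cases "i \<in> X")
  case False
  then have "X \<subseteq> {..<i}" using X by (auto simp: prefix_mis_def less_Suc_eq)
  then show ?thesis
    using X False by (intro exI[of _ X]) (auto simp: prefix_mis_def children_def has_nbr_def)
next
  case True
  define J where "J = X - {i}"
  have J: "J \<subseteq> {..<i}" "stable J"
    using X by (auto simp: J_def prefix_mis_def stable_def less_Suc_eq)
  have "stable X" using X by (simp add: prefix_mis_def)
  with True have Xi: "\<not> adj i w" if "w \<in> X" for w
    using that unfolding stable_def by blast
  obtain I where I: "J \<subseteq> I" "I \<subseteq> {..<i} \<union> J" "stable I"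
    "\<And>u. u < i \<Longrightarrow> u \<notin> I \<Longrightarrow> \<exists>w\<in>I. adj u w \<and> (w \<in> J \<or> w < u)"
    using greedy_completion[OF J order_refl] by blast
  have Ii: "I \<subseteq> {..<i}" using I J by auto
  \<comment> \<open>The completion adds only neighbours of \<open>i\<close>: by maximality of
    \<open>X\<close> any other \<open>w\<close> has a neighbour in \<open>X\<close>, which is not
    \<open>i\<close>, so it lies in \<open>J\<close> and hence in the stable set
    \<open>I\<close>.\<close>
  have rest: "w \<in> J" if w: "w \<in> I" "\<not> adj i w" for w
  proof (rule ccontr)
    assume "w \<notin> J"
    with w Ii have "w < Suc i" "w \<notin> X" by (auto simp: J_def)
    with X obtain z where z: "z \<in> X" "adj w z" by (auto simp: prefix_mis_def)
    with w have "z \<in> J" by (auto simp: J_def adj_sym)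
    with z w I show False by (auto simp: stable_def)
  qed
  have "prefix_mis i I"
    using I Ii unfolding prefix_mis_def by blast
  moreover have "X = swap i I"
    using rest I(1) Xi True by (auto simp: swap_def J_def)
  moreover have "canonical i I"
    unfolding canonical_def
  proof (intro allI impI)
    fix u assume u: "u < i" "u \<notin> I"
    show "\<exists>w\<in>I. adj u w \<and> (\<not> adj i w \<or> (w < u \<and> adj i u))"
    proof (cases "adj i u")
      case True
      \<comment> \<open>\<open>J\<close> contains no neighbour of \<open>i\<close>, so both
        alternatives of the greedy condition fit.\<close>
      then show ?thesis using I(4)[OF u] Xi by (auto simp: J_def)
    next
      case False
      have "u \<notin> X" using u I(1) by (auto simp: J_def)
      with u X obtain w where w: "w \<in> X" "adj u w"
        by (auto simp: prefix_mis_def less_Suc_eq)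
      with False have "w \<in> I" using I(1) by (auto simp: J_def adj_sym)
      with w Xi show ?thesis by blast
    qed
  qed
  ultimately show ?thesis by (auto simp: children_def)
qed

text \<open>Non-neighbours of \<open>i\<close> in \<open>I\<close> are read off
  \<open>swap i I\<close>. Membership of the neighbours follows by recursion in increasing order,
  because an omitted vertex is blocked by a non-neighbour of \<open>i\<close> or by a smaller
  vertex.\<close>

lemma swap_inj:
  assumes I: "prefix_mis i I" "canonical i I" and I': "prefix_mis i I'" "canonical i I'"
    and eq: "swap i I = swap i I'"
  shows "I = I'"
proof -
  have keep: "w \<in> I \<longleftrightarrow> w \<in> I'" if "\<not> adj i w" "w < i" for w
    using eq that by (auto simp: swap_def)
  have "u < i \<Longrightarrow> u \<in> I \<longleftrightarrow> u \<in> I'" for u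
  proof (induction u rule: less_induct)
    case (less u)
    \<comment> \<open>Stated for arbitrary \<open>Y\<close> and \<open>Z\<close>, so that it serves
      both directions.\<close>
    have *: "u \<notin> Y" if Y: "prefix_mis i Y" and Z: "prefix_mis i Z" "canonical i Z" "u \<notin> Z"
      and keep': "\<And>w. \<not> adj i w \<Longrightarrow> w < i \<Longrightarrow> w \<in> Z \<longleftrightarrow> w \<in> Y"
      and IH: "\<And>w. w < u \<Longrightarrow> w < i \<Longrightarrow> w \<in> Z \<longleftrightarrow> w \<in> Y" for Y Z
    proof -
      from Z less.prems obtain w where w: "w \<in> Z" "adj u w" "\<not> adj i w \<or> w < u"
        by (auto simp: canonical_def)
      with Z have "w < i" by (auto simp: prefix_mis_def)
      with w keep' IH have "w \<in> Y" by blast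
      with w Y show ?thesis by (auto simp: prefix_mis_def stable_def)
    qed
    show ?case
      using *[OF I'(1) I] *[OF I(1) I'] keep less.IH by blast
  qed
  then show ?thesis
    using I(1) I'(1) by (auto simp: prefix_mis_def)
qed

lemma children_disjoint:
  assumes "prefix_mis i I" "prefix_mis i I'" "I \<noteq> I'"
  shows "set (children i I) \<inter> set (children i I') = {}"
proof -
  have "i \<in> swap i Y" for Y by (simp add: swap_def)
  moreover have "i \<notin> I" "i \<notin> I'" using assms by (auto simp: prefix_mis_def)
  ultimately have "swap i I \<noteq> I'" "swap i I' \<noteq> I" by metis+
  then show ?thesis
    using assms swap_inj[of i I I'] by (auto simp: children_def)
qed

lemma distinct_children: "prefix_mis i I \<Longrightarrow> distinct (children i I)"
  by (auto simp: children_def swap_def prefix_mis_def)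

primrec level :: "nat \<Rightarrow> nat set list" where
  "level 0 = [{}]"
| "level (Suc i) = concat (map (children i) (level i))"

text \<open>Uniqueness of parents gives distinctness, existence of parents gives
  completeness.\<close>

lemma level_correct: "distinct (level i) \<and> set (level i) = {I. prefix_mis i I}"
proof (induction i)
  case 0
  show ?case by (auto simp: prefix_mis_def stable_def)
next
  case (Suc i)
  have "distinct (concat (map (children i) L))"
    if "distinct L" "\<forall>I\<in>set L. prefix_mis i I" for L
    using that
  proof (induction L)
    case (Cons I L)
    then show ?case
      using children_disjoint[of i I] distinct_children[of i I] by fastforce
  qed simp
  then show ?case
    using Suc children_prefix_mis prefix_mis_has_parent by fastforce
qed

section \<open>Counting by traces on the cliques\<close>

text \<open>A maximal independent set is determined by its traces on the \<open>l\<close> cliques,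
  each empty or a singleton. The partition of the whole graph serves every prefix.\<close>

lemma card_prefix_mis_le:
  assumes part: "kl_partition 1 l {..<n} E S K" and "i \<le> n"
  shows "card {I. prefix_mis i I} \<le> (n + 1) ^ l"
proof -
  define C where "C = insert {} ((\<lambda>v. {v}) ` {..<n})"
  \<comment> \<open>Restricted to \<open>{..<l}\<close>, so that the traces form an extensional
    function and \<open>card_PiE\<close> counts them.\<close>
  define f where "f = (\<lambda>I. \<lambda>j\<in>{..<l}. I \<inter> K j)"
  have cover: "v \<in> S 0 \<or> (\<exists>j<l. v \<in> K j)" if "v < n" for v
    using part that by (auto simp: kl_partition_def)
  have S: "stable (S 0)"
    using part by (simp add: kl_partition_def indep_iff_stable)
  have K: "adj u w" if "j < l" "u \<in> K j" "w \<in> K j" "u \<noteq> w" for j u w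
    using part that by (auto simp: kl_partition_def clique_def adj_def)
  have "f I \<in> {..<l} \<rightarrow>\<^sub>E C" if I: "prefix_mis i I" for I
  proof (rule PiE_I)
    fix j assume j: "j \<in> {..<l}"
    have eq: "u = w" if "u \<in> I \<inter> K j" "w \<in> I \<inter> K j" for u w
      using I K[of j u w] that j by (auto simp: prefix_mis_def stable_def)
    have "I \<inter> K j \<in> C"
    proof (cases "I \<inter> K j = {}")
      case False
      then obtain v where v: "v \<in> I \<inter> K j" by blast
      with eq have "I \<inter> K j = {v}" by blast
      moreover have "v < n" using v I \<open>i \<le> n\<close> by (auto simp: prefix_mis_def)
      ultimately show ?thesis by (auto simp: C_def)
    qed (simp add: C_def)
    with j show "f I j \<in> C" by (simp add: f_def)
  qed (simp add: f_def)
  then have range: "f ` {I. prefix_mis i I} \<subseteq> {..<l} \<rightarrow>\<^sub>E C" by blast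
  \<comment> \<open>A vertex \<open>u\<close> of \<open>I - I'\<close> has a neighbour
    \<open>w\<close> in \<open>I'\<close>. Equal traces keep both out of the cliques, so both lie in
    the stable set \<open>S 0\<close>.\<close>
  have sub: "I \<subseteq> I'" if I: "prefix_mis i I" and I': "prefix_mis i I'" and eq: "f I = f I'" for I I'
  proof
    have same: "v \<in> I \<longleftrightarrow> v \<in> I'" if "j < l" "v \<in> K j" for v j
      using fun_cong[OF eq, of j] that by (auto simp: f_def)
    fix u assume u: "u \<in> I"
    show "u \<in> I'"
    proof (rule ccontr)
      assume "u \<notin> I'"
      with u I I' obtain w where w: "w \<in> I'" "adj u w"
        unfolding prefix_mis_def by blast
      show False
      proof (cases "\<exists>j<l. w \<in> K j")
        case True
        with w same have "w \<in> I" by blast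
        with w u I show False by (auto simp: prefix_mis_def stable_def)
      next
        case False
        then have "w \<in> S 0" using cover[OF adj_less(2)] w by blast
        moreover have "u \<in> S 0"
          using cover[OF adj_less(1)] w same u \<open>u \<notin> I'\<close> by blast
        ultimately show False using S w by (auto simp: stable_def)
      qed
    qed
  qed
  have inj: "inj_on f {I. prefix_mis i I}"
    using sub by (intro inj_onI equalityI) auto
  have "card {I. prefix_mis i I} \<le> card ({..<l} \<rightarrow>\<^sub>E C)"
    using card_inj_on_le[OF inj range] by (simp add: finite_PiE C_def)
  also have "\<dots> = card C ^ l"
    by (simp add: card_PiE)
  also have "card C = n + 1"
    by (simp add: C_def card_image inj_on_def image_iff)
  finally show ?thesis .
qed

lemma length_level_le:
  assumes "kl_partition 1 l {..<n} E S K" and "i \<le> n"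
  shows "length (level i) \<le> (n + 1) ^ l"
  using card_prefix_mis_le[OF assms] level_correct[of i] distinct_card[of "level i"] by simp

section \<open>Leaves and size of the tree\<close>

text \<open>The number is the height left: a node of height \<open>Suc k\<close> has depth
  \<open>n - Suc k\<close>, which is also the vertex to be decided next.\<close>

primrec leaves :: "nat \<Rightarrow> nat set \<Rightarrow> nat set list" where
  "leaves 0 I = [I]"
| "leaves (Suc k) I = concat (map (leaves k) (children (n - Suc k) I))"

primrec tree_size :: "nat \<Rightarrow> nat set \<Rightarrow> nat" where
  "tree_size 0 I = 1"
| "tree_size (Suc k) I = 1 + sum_list (map (tree_size k) (children (n - Suc k) I))"

text \<open>Depth-first and level order agree on the leaves, as both expand children from left to
  right.\<close>

lemma leaves_level:
  "k \<le> n \<Longrightarrow> concat (map (leaves k) (level (n - k))) = level n"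
proof (induction k)
  case 0
  show ?case by (simp add: concat_map_singleton[of "\<lambda>x. x", simplified])
next
  case (Suc k)
  have "concat (map (leaves (Suc k)) L)
      = concat (map (leaves k) (concat (map (children (n - Suc k)) L)))" for L
    by (induction L) auto
  moreover have "level (n - k) = concat (map (children (n - Suc k)) (level (n - Suc k)))"
    using Suc.prems by (subst level.simps(2)[symmetric]) (simp add: Suc_diff_Suc)
  ultimately show ?case using Suc by (simp del: leaves.simps map_concat)
qed

lemma leaves_root: "leaves n {} = level n"
  using leaves_level[of n] by simp

lemma tree_size_level:
  "k \<le> n \<Longrightarrow> sum_list (map (tree_size k) (level (n - k))) = (\<Sum>i\<in>{n-k..n}. length (level i))"
proof (induction k)
  case 0
  show ?case by (simp add: sum_list_triv)
next
  case (Suc k)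
  have "sum_list (map (tree_size (Suc k)) L)
      = length L + sum_list (map (tree_size k) (concat (map (children (n - Suc k)) L)))" for L
    by (induction L) auto
  moreover have "level (n - k) = concat (map (children (n - Suc k)) (level (n - Suc k)))"
    using Suc.prems by (subst level.simps(2)[symmetric]) (simp add: Suc_diff_Suc)
  moreover have "{n - Suc k..n} = insert (n - Suc k) {n - k..n}"
    using Suc.prems by auto
  ultimately show ?case using Suc by (simp del: tree_size.simps map_concat)
qed

lemma tree_size_root_le:
  assumes "kl_partition 1 l {..<n} E S K"
  shows "tree_size n {} \<le> (n + 1) ^ Suc l"
proof -
  have "tree_size n {} = (\<Sum>i\<in>{0..n}. length (level i))"
    using tree_size_level[of n] by simp
  also have "\<dots> \<le> (\<Sum>i\<in>{0..n}. (n + 1) ^ l)"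
    by (intro sum_mono length_level_le[OF assms]) auto
  finally show ?thesis by simp
qed

end

section \<open>A small language compiled to the machine\<close>

text \<open>Sums up to \<open>n\<close> stand in for multiplication by \<open>n\<close> and for
  existential quantifiers over vertices.\<close>

datatype exp =
    Const nat
  | Var nat
  | Plus exp exp
  | Minus exp exp
  | Mem exp
  | IfE exp exp exp
  | SumE nat exp

fun ev :: "nat \<Rightarrow> exp \<Rightarrow> (nat \<Rightarrow> nat) \<Rightarrow> (nat \<Rightarrow> nat) \<Rightarrow> nat" where
  "ev n (Const c) \<rho> \<mu> = c"
| "ev n (Var x) \<rho> \<mu> = \<rho> x"
| "ev n (Plus a b) \<rho> \<mu> = ev n a \<rho> \<mu> + ev n b \<rho> \<mu>"
| "ev n (Minus a b) \<rho> \<mu> = ev n a \<rho> \<mu> - ev n b \<rho> \<mu>"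
| "ev n (Mem a) \<rho> \<mu> = \<mu> (ev n a \<rho> \<mu>)"
| "ev n (IfE a b c) \<rho> \<mu> = (if ev n a \<rho> \<mu> \<noteq> 0 then ev n b \<rho> \<mu> else ev n c \<rho> \<mu>)"
| "ev n (SumE x b) \<rho> \<mu> = (\<Sum>j<n. ev n b (\<rho>(x := j)) \<mu>)"

text \<open>
  Compiled code leaves the value in register \<open>k\<close> and changes only registers from \<open>k\<close> on; \<open>\<sigma>\<close> says
  which register holds a variable. Register 0 must hold \<open>n\<close>, the bound of all sums.
\<close>

definition sum_body :: "nat \<Rightarrow> prog \<Rightarrow> prog" where
  "sum_body k c = Seq c (Seq (Instr (ADD k k (k + 2))) (Seq (Instr (SET (k + 2) 1))
     (Seq (Instr (ADD (k + 1) (k + 1) (k + 2))) (Instr (SUB (k + 2) 0 (k + 1))))))"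

fun comp_exp :: "(nat \<Rightarrow> nat) \<Rightarrow> nat \<Rightarrow> exp \<Rightarrow> prog" where
  "comp_exp \<sigma> k (Const c) = Instr (SET k c)"
| "comp_exp \<sigma> k (Var x) = Seq (Instr (SET k 0)) (Instr (ADD k k (\<sigma> x)))"
| "comp_exp \<sigma> k (Plus a b) =
     Seq (comp_exp \<sigma> k a) (Seq (comp_exp \<sigma> (k + 1) b) (Instr (ADD k k (k + 1))))"
| "comp_exp \<sigma> k (Minus a b) =
     Seq (comp_exp \<sigma> k a) (Seq (comp_exp \<sigma> (k + 1) b) (Instr (SUB k k (k + 1))))"
| "comp_exp \<sigma> k (Mem a) = Seq (comp_exp \<sigma> k a) (Instr (LOAD k k))"
| "comp_exp \<sigma> k (IfE a b c) =
     Seq (comp_exp \<sigma> k a) (Cond k (comp_exp \<sigma> k b) (comp_exp \<sigma> k c))"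
| "comp_exp \<sigma> k (SumE x b) =
     Seq (Instr (SET k 0)) (Seq (Instr (SET (k + 1) 0)) (Seq (Instr (SUB (k + 2) 0 (k + 1)))
       (Loop (k + 2) (sum_body k (comp_exp (\<sigma>(x := k + 1)) (k + 2) b)))))"

text \<open>Both branches of \<open>IfE\<close> are charged. A round of a sum adds four instructions
  and one test; entering and leaving the loop takes three instructions and one test.\<close>

fun exp_time :: "exp \<Rightarrow> nat poly" where
  "exp_time (Const c) = 1"
| "exp_time (Var x) = 2"
| "exp_time (Plus a b) = exp_time a + exp_time b + 1"
| "exp_time (Minus a b) = exp_time a + exp_time b + 1"
| "exp_time (Mem a) = exp_time a + 1"
| "exp_time (IfE a b c) = exp_time a + exp_time b + exp_time c + 1"
| "exp_time (SumE x b) = [:0, 1:] * (exp_time b + 5) + 4"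

section \<open>Total correctness with time bounds\<close>

definition halts_in :: "prog \<Rightarrow> state \<Rightarrow> nat \<Rightarrow> (state \<Rightarrow> bool) \<Rightarrow> bool" where
  "halts_in c s T P \<longleftrightarrow> (\<exists>t s'. steps c s t s' \<and> t \<le> T \<and> P s')"

lemma halts_in_mono:
  "halts_in c s T P \<Longrightarrow> T \<le> T' \<Longrightarrow> (\<And>s'. P s' \<Longrightarrow> P' s') \<Longrightarrow> halts_in c s T' P'"
  unfolding halts_in_def by (meson order_trans)

lemma halts_in_Instr: "P (exec i s) \<Longrightarrow> halts_in (Instr i) s 1 P"
  unfolding halts_in_def using steps.Instr by blast

lemma halts_in_Seq:
  assumes "halts_in c s T P" "\<And>s'. P s' \<Longrightarrow> halts_in d s' U Q"
  shows "halts_in (Seq c d) s (T + U) Q"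
  using assms unfolding halts_in_def by (meson add_mono steps.Seq)

lemma halts_in_Instr_Seq:
  "halts_in d (exec i s) U Q \<Longrightarrow> halts_in (Seq (Instr i) d) s (Suc U) Q"
  using halts_in_Seq[OF halts_in_Instr[of "\<lambda>s'. s' = exec i s"]] by simp

lemma halts_in_Cond:
  assumes "reg s r \<noteq> 0 \<Longrightarrow> halts_in c s T P" "reg s r = 0 \<Longrightarrow> halts_in d s U P"
  shows "halts_in (Cond r c d) s (1 + (T + U)) P"
proof (cases "reg s r = 0")
  case True
  then obtain t s' where "steps d s t s'" "t \<le> U" "P s'"
    using assms(2) by (auto simp: halts_in_def)
  with True show ?thesis
    unfolding halts_in_def by (intro exI[of _ "1 + t"] exI[of _ s'])
      (auto intro: steps.CondF[unfolded plus_1_eq_Suc])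
next
  case False
  then obtain t s' where "steps c s t s'" "t \<le> T" "P s'"
    using assms(1) by (auto simp: halts_in_def)
  with False show ?thesis
    unfolding halts_in_def by (intro exI[of _ "1 + t"] exI[of _ s'])
      (auto intro: steps.CondT[unfolded plus_1_eq_Suc])
qed

text \<open>The index \<open>m\<close> of the invariant counts the remaining iterations.\<close>

lemma halts_in_Loop:
  assumes body: "\<And>m s. Inv (Suc m) s \<Longrightarrow> halts_in c s T (Inv m)"
    and test: "\<And>m s. Inv m s \<Longrightarrow> reg s r = 0 \<longleftrightarrow> m = 0"
    and start: "Inv m s"
  shows "halts_in (Loop r c) s (m * (T + 1) + 1) (Inv 0)"
  using start
proof (induction m arbitrary: s)
  case 0
  then show ?case
    using test[OF 0] steps.LoopF[of s r c] by (auto simp: halts_in_def)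
next
  case (Suc m)
  from body[OF Suc.prems] obtain t s' where s': "steps c s t s'" "t \<le> T" "Inv m s'"
    by (auto simp: halts_in_def)
  from Suc.IH[OF s'(3)] obtain u s'' where s'': "steps (Loop r c) s' u s''"
    "u \<le> m * (T + 1) + 1" "Inv 0 s''"
    by (auto simp: halts_in_def)
  have "steps (Loop r c) s (1 + t + u) s''"
    using test[OF Suc.prems] s'(1) s''(1) by (intro steps.LoopT) auto
  with s' s'' show ?case
    unfolding halts_in_def by (intro exI[of _ "1 + t + u"] exI[of _ s'']) auto
qed

definition evaluates :: "nat \<Rightarrow> nat \<Rightarrow> state \<Rightarrow> state \<Rightarrow> bool" where
  "evaluates k v s s' \<longleftrightarrow>
     mem s' = mem s \<and> out s' = out s \<and> (\<forall>r<k. reg s' r = reg s r) \<and> reg s' k = v"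

text \<open>Registers from \<open>k\<close> on act as an evaluation stack, so computing the second
  operand at \<open>k + 1\<close> cannot disturb the first. A sum redirects its variable to
  \<open>k + 1\<close>, hence the generalisation over \<open>\<sigma>\<close> and
  \<open>\<rho>\<close>.\<close>

lemma comp_exp_correct:
  assumes "reg s 0 = n" "0 < k" "\<And>x. \<sigma> x < k" "\<And>x. reg s (\<sigma> x) = \<rho> x"
  shows "halts_in (comp_exp \<sigma> k e) s (poly (exp_time e) n)
    (evaluates k (ev n e \<rho> (mem s)) s)"
  using assms
proof (induction e arbitrary: \<sigma> \<rho> k s)
  case (Const c)
  then show ?case
    using halts_in_Instr[of _ "SET k c" s] by (simp add: evaluates_def)
next
  case (Var x)
  have "halts_in (comp_exp \<sigma> k (Var x)) s (Suc 1)
    (evaluates k (ev n (Var x) \<rho> (mem s)) s)"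
    using Var.prems(3,4)[of x]
    by (auto intro!: halts_in_Instr_Seq halts_in_Instr[unfolded One_nat_def]
        simp: evaluates_def numeral_2_eq_2)
  then show ?case by (simp add: numeral_2_eq_2)
next
  case (Plus a b)
  have "halts_in (comp_exp \<sigma> k (Plus a b)) s (poly (exp_time a) n + (poly (exp_time b) n + 1))
    (evaluates k (ev n (Plus a b) \<rho> (mem s)) s)"
    unfolding comp_exp.simps
  proof (rule halts_in_Seq[OF Plus.IH(1)[OF Plus.prems]], rule halts_in_Seq)
    fix s1 assume s1: "evaluates k (ev n a \<rho> (mem s)) s s1"
    show "halts_in (comp_exp \<sigma> (k + 1) b) s1 (poly (exp_time b) n)
      (evaluates (k + 1) (ev n b \<rho> (mem s1)) s1)"
      using s1 Plus.prems by (intro Plus.IH(2)) (auto simp: evaluates_def less_Suc_eq)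
    fix s2 assume "evaluates (k + 1) (ev n b \<rho> (mem s1)) s1 s2"
    then show "halts_in (Instr (ADD k k (k + 1))) s2 1
      (evaluates k (ev n (Plus a b) \<rho> (mem s)) s)"
      using s1 by (intro halts_in_Instr) (auto simp: evaluates_def)
  qed
  then show ?case
    by (simp only: exp_time.simps poly_add poly_1 add.assoc)
next
  case (Minus a b)
  have "halts_in (comp_exp \<sigma> k (Minus a b)) s (poly (exp_time a) n + (poly (exp_time b) n + 1))
    (evaluates k (ev n (Minus a b) \<rho> (mem s)) s)"
    unfolding comp_exp.simps
  proof (rule halts_in_Seq[OF Minus.IH(1)[OF Minus.prems]], rule halts_in_Seq)
    fix s1 assume s1: "evaluates k (ev n a \<rho> (mem s)) s s1"
    show "halts_in (comp_exp \<sigma> (k + 1) b) s1 (poly (exp_time b) n)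
      (evaluates (k + 1) (ev n b \<rho> (mem s1)) s1)"
      using s1 Minus.prems by (intro Minus.IH(2)) (auto simp: evaluates_def less_Suc_eq)
    fix s2 assume "evaluates (k + 1) (ev n b \<rho> (mem s1)) s1 s2"
    then show "halts_in (Instr (SUB k k (k + 1))) s2 1
      (evaluates k (ev n (Minus a b) \<rho> (mem s)) s)"
      using s1 by (intro halts_in_Instr) (auto simp: evaluates_def)
  qed
  then show ?case
    by (simp only: exp_time.simps poly_add poly_1 add.assoc)
next
  case (Mem a)
  have "halts_in (comp_exp \<sigma> k (Mem a)) s (poly (exp_time a) n + 1)
    (evaluates k (ev n (Mem a) \<rho> (mem s)) s)"
    unfolding comp_exp.simps
    by (rule halts_in_Seq[OF Mem.IH[OF Mem.prems]], rule halts_in_Instr)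
      (auto simp: evaluates_def)
  then show ?case by simp
next
  case (IfE a b c)
  have "halts_in (comp_exp \<sigma> k (IfE a b c)) s
    (poly (exp_time a) n + (1 + (poly (exp_time b) n + poly (exp_time c) n)))
    (evaluates k (ev n (IfE a b c) \<rho> (mem s)) s)"
    unfolding comp_exp.simps
  proof (rule halts_in_Seq[OF IfE.IH(1)[OF IfE.prems]], rule halts_in_Cond)
    fix s1 assume s1: "evaluates k (ev n a \<rho> (mem s)) s s1"
    have n: "reg s1 0 = n" and \<rho>: "reg s1 (\<sigma> x) = \<rho> x" for x
      using s1 IfE.prems by (auto simp: evaluates_def)
    show "halts_in (comp_exp \<sigma> k b) s1 (poly (exp_time b) n)
      (evaluates k (ev n (IfE a b c) \<rho> (mem s)) s)" if "reg s1 k \<noteq> 0"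
      by (rule halts_in_mono[OF IfE.IH(2)[OF n IfE.prems(2,3) \<rho>] order_refl])
        (use s1 that in \<open>auto simp: evaluates_def\<close>)
    show "halts_in (comp_exp \<sigma> k c) s1 (poly (exp_time c) n)
      (evaluates k (ev n (IfE a b c) \<rho> (mem s)) s)" if "reg s1 k = 0"
      by (rule halts_in_mono[OF IfE.IH(3)[OF n IfE.prems(2,3) \<rho>] order_refl])
        (use s1 that in \<open>auto simp: evaluates_def\<close>)
  qed
  then show ?case by (simp add: algebra_simps)
next
  case (SumE x b)
  define f where "f j = ev n b (\<rho>(x := j)) (mem s)" for j
  \<comment> \<open>Register \<open>k\<close> accumulates, \<open>k + 1\<close> is the index, and
    \<open>k + 2\<close> holds the number of remaining rounds; within a round it also takes the
    summand and the constant 1.\<close>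
  define Inv where "Inv m s' \<longleftrightarrow> m \<le> n \<and> mem s' = mem s \<and> out s' = out s \<and>
    (\<forall>r<k. reg s' r = reg s r) \<and> reg s' k = (\<Sum>j<n - m. f j) \<and>
    reg s' (k + 1) = n - m \<and> reg s' (k + 2) = m" for m and s' :: state
  have body: "halts_in (sum_body k (comp_exp (\<sigma>(x := k + 1)) (k + 2) b)) s1
    (poly (exp_time b) n + Suc (Suc (Suc 1))) (Inv m)" if s1: "Inv (Suc m) s1" for m s1
    unfolding sum_body_def
  proof (rule halts_in_Seq)
    show "halts_in (comp_exp (\<sigma>(x := k + 1)) (k + 2) b) s1 (poly (exp_time b) n)
      (evaluates (k + 2) (ev n b (\<rho>(x := n - Suc m)) (mem s1)) s1)"
      by (rule SumE.IH) (use s1 SumE.prems in \<open>auto simp: Inv_def less_Suc_eq trans_less_add1\<close>)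
    fix s2 assume "evaluates (k + 2) (ev n b (\<rho>(x := n - Suc m)) (mem s1)) s1 s2"
    then have s2: "mem s2 = mem s" "out s2 = out s" "\<And>r. r < k \<Longrightarrow> reg s2 r = reg s r"
      "reg s2 k = (\<Sum>j<n - Suc m. f j)" "reg s2 (Suc k) = n - Suc m"
      "reg s2 (Suc (Suc k)) = f (n - Suc m)"
      using s1 unfolding evaluates_def Inv_def f_def by auto
    have m: "n - m = Suc (n - Suc m)" "Suc m \<le> n" using s1 by (auto simp: Inv_def)
    have "reg s2 0 = n" using s2(3) SumE.prems by simp
    then show "halts_in (Seq (Instr (ADD k k (k + 2))) (Seq (Instr (SET (k + 2) 1))
     (Seq (Instr (ADD (k + 1) (k + 1) (k + 2))) (Instr (SUB (k + 2) 0 (k + 1))))))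
     s2 (Suc (Suc (Suc 1))) (Inv m)"
      using s2 m SumE.prems(2)
      by (intro halts_in_Instr_Seq halts_in_Instr) (auto simp: Inv_def)
  qed
  define s0 where "s0 = exec (SUB (k + 2) 0 (k + 1)) (exec (SET (k + 1) 0) (exec (SET k 0) s))"
  have "Inv n s0"
    using SumE.prems by (auto simp: Inv_def s0_def)
  from halts_in_Loop[of Inv, OF body _ this]
  have "halts_in (Loop (k + 2) (sum_body k (comp_exp (\<sigma>(x := k + 1)) (k + 2) b))) s0
    (n * (poly (exp_time b) n + Suc (Suc (Suc 1)) + 1) + 1) (Inv 0)"
    by (auto simp: Inv_def)
  then have "halts_in (comp_exp \<sigma> k (SumE x b)) s
    (Suc (Suc (Suc (n * (poly (exp_time b) n + Suc (Suc (Suc 1)) + 1) + 1)))) (Inv 0)"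
    unfolding comp_exp.simps s0_def by (intro halts_in_Instr_Seq)
  then show ?case
    by (rule halts_in_mono) (auto simp: Inv_def evaluates_def f_def algebra_simps)
qed

section \<open>Commands and their compilation\<close>

datatype cmd =
    Skip
  | Assign nat exp
  | Store exp exp
  | Output exp
  | CSeq cmd cmd
  | CIf exp cmd cmd
  | For nat cmd

definition num_vars :: nat where "num_vars = 6"

lemma num_vars_pos [simp]: "0 < num_vars"
  by (simp add: num_vars_def)

text \<open>Variables from \<open>num_vars\<close> on are meant to be bound by sums, which redirect
  them; the default 0 keeps every register below the scratch space.\<close>

definition var_reg :: "nat \<Rightarrow> nat" where
  "var_reg x = (if x < num_vars then x else 0)"

lemma var_reg_less [simp]: "var_reg x < num_vars"
  by (simp add: var_reg_def)

abbreviation eval :: "nat \<Rightarrow> exp \<Rightarrow> state \<Rightarrow> nat" where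
  "eval n e s \<equiv> ev n e (reg s \<circ> var_reg) (mem s)"

definition set_reg :: "nat \<Rightarrow> nat \<Rightarrow> state \<Rightarrow> state" where
  "set_reg x v s = s\<lparr>reg := (reg s)(x := v)\<rparr>"

lemma set_reg_simps [simp]:
  "reg (set_reg x v s) = (reg s)(x := v)" "mem (set_reg x v s) = mem s"
  "out (set_reg x v s) = out s"
  by (simp_all add: set_reg_def)

text \<open>\<open>For\<close> leaves its variable at \<open>n\<close>, as the compiled counter
  does.\<close>

primrec den :: "nat \<Rightarrow> cmd \<Rightarrow> state \<Rightarrow> state" where
  "den n Skip s = s"
| "den n (Assign x e) s = set_reg x (eval n e s) s"
| "den n (Store a e) s = s\<lparr>mem := (mem s)(eval n a s := eval n e s)\<rparr>"
| "den n (Output e) s = s\<lparr>out := out s @ [eval n e s]\<rparr>"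
| "den n (CSeq c d) s = den n d (den n c s)"
| "den n (CIf e c d) s = (if eval n e s \<noteq> 0 then den n c s else den n d s)"
| "den n (For x c) s =
     set_reg x n (fold (\<lambda>j s. den n c (set_reg x j s)) [0..<n] s)"

primrec assigned :: "cmd \<Rightarrow> nat set" where
  "assigned Skip = {}"
| "assigned (Assign x e) = {x}"
| "assigned (Store a e) = {}"
| "assigned (Output e) = {}"
| "assigned (CSeq c d) = assigned c \<union> assigned d"
| "assigned (CIf e c d) = assigned c \<union> assigned d"
| "assigned (For x c) = insert x (assigned c)"

text \<open>Register 0 must keep \<open>n\<close>, and the body of a loop must spare the loop
  variable, since the compiled loop counts with it.\<close>

primrec wf_cmd :: "cmd \<Rightarrow> bool" where
  "wf_cmd Skip \<longleftrightarrow> True"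
| "wf_cmd (Assign x e) \<longleftrightarrow> 0 < x \<and> x < num_vars"
| "wf_cmd (Store a e) \<longleftrightarrow> True"
| "wf_cmd (Output e) \<longleftrightarrow> True"
| "wf_cmd (CSeq c d) \<longleftrightarrow> wf_cmd c \<and> wf_cmd d"
| "wf_cmd (CIf e c d) \<longleftrightarrow> wf_cmd c \<and> wf_cmd d"
| "wf_cmd (For x c) \<longleftrightarrow> 0 < x \<and> x < num_vars \<and> x \<notin> assigned c \<and> wf_cmd c"

definition for_body :: "nat \<Rightarrow> prog \<Rightarrow> prog" where
  "for_body x c = Seq c (Seq (Instr (SET num_vars 1)) (Seq (Instr (ADD x x num_vars))
     (Instr (SUB num_vars 0 x))))"

abbreviation comp_var_exp :: "exp \<Rightarrow> prog" where
  "comp_var_exp \<equiv> comp_exp var_reg num_vars"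

primrec comp_cmd :: "cmd \<Rightarrow> prog" where
  "comp_cmd Skip = Instr (SET num_vars 0)"
| "comp_cmd (Assign x e) =
     Seq (comp_var_exp e) (Seq (Instr (SET x 0)) (Instr (ADD x x num_vars)))"
| "comp_cmd (Store a e) =
     Seq (comp_var_exp a) (Seq (comp_exp var_reg (num_vars + 1) e)
       (Instr (STORE num_vars (num_vars + 1))))"
| "comp_cmd (Output e) = Seq (comp_var_exp e) (Instr (OUT num_vars))"
| "comp_cmd (CSeq c d) = Seq (comp_cmd c) (comp_cmd d)"
| "comp_cmd (CIf e c d) = Seq (comp_var_exp e) (Cond num_vars (comp_cmd c) (comp_cmd d))"
| "comp_cmd (For x c) =
     Seq (Instr (SET x 0)) (Seq (Instr (SUB num_vars 0 x))
       (Loop num_vars (for_body x (comp_cmd c))))"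

primrec cmd_time :: "cmd \<Rightarrow> nat poly" where
  "cmd_time Skip = 1"
| "cmd_time (Assign x e) = exp_time e + 2"
| "cmd_time (Store a e) = exp_time a + exp_time e + 1"
| "cmd_time (Output e) = exp_time e + 1"
| "cmd_time (CSeq c d) = cmd_time c + cmd_time d"
| "cmd_time (CIf e c d) = exp_time e + cmd_time c + cmd_time d + 1"
| "cmd_time (For x c) = [:0, 1:] * (cmd_time c + 4) + 3"

text \<open>Compiled code clobbers the registers from \<open>num_vars\<close> on, so they are left
  out.\<close>

definition agree :: "state \<Rightarrow> state \<Rightarrow> bool" where
  "agree s s' \<longleftrightarrow> mem s' = mem s \<and> out s' = out s \<and> (\<forall>r<num_vars. reg s' r = reg s r)"

lemma agree_refl [simp]: "agree s s"
  by (simp add: agree_def)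

lemma den_unassigned: "x \<notin> assigned c \<Longrightarrow> reg (den n c s) x = reg s x"
proof (induction c arbitrary: s)
  case (For y c)
  have "reg (fold (\<lambda>j s. den n c (set_reg y j s)) js s) x = reg s x" for js
    using For by (induction js arbitrary: s) auto
  then show ?case using For.prems by simp
qed auto

lemma zero_unassigned: "wf_cmd c \<Longrightarrow> 0 \<notin> assigned c"
  by (induction c) auto

lemma comp_var_exp_correct:
  assumes "agree s1 s" "reg s1 0 = n"
  shows "halts_in (comp_var_exp e) s (poly (exp_time e) n)
    (\<lambda>s'. agree s1 s' \<and> reg s' num_vars = eval n e s1)"
  using assms
  by (intro halts_in_mono[OF comp_exp_correct[of s n num_vars var_reg "reg s1 \<circ> var_reg" e] order_refl])
    (auto simp: agree_def evaluates_def)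

text \<open>\<open>s1\<close> is the idealised state and \<open>s\<close> the machine state; letting
  them differ in scratch registers makes the statement compose.\<close>

lemma comp_cmd_correct:
  assumes "wf_cmd c" "agree s1 s" "reg s1 0 = n"
  shows "halts_in (comp_cmd c) s (poly (cmd_time c) n) (agree (den n c s1))"
  using assms
proof (induction c arbitrary: s s1)
  case Skip
  then show ?case using halts_in_Instr[of _ "SET num_vars 0" s] by (simp add: agree_def)
next
  case (Assign x e)
  have "halts_in (comp_cmd (Assign x e)) s (poly (exp_time e) n + Suc 1)
    (agree (den n (Assign x e) s1))"
    unfolding comp_cmd.simps
    by (rule halts_in_Seq[OF comp_var_exp_correct[OF Assign.prems(2,3)]],
        rule halts_in_Instr_Seq, rule halts_in_Instr)
      (use Assign.prems in \<open>auto simp: agree_def\<close>)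
  then show ?case by (simp add: numeral_2_eq_2)
next
  case (Store a e)
  have "halts_in (comp_cmd (Store a e)) s (poly (exp_time a) n + (poly (exp_time e) n + 1))
    (agree (den n (Store a e) s1))"
    unfolding comp_cmd.simps
  proof (rule halts_in_Seq[OF comp_var_exp_correct[OF Store.prems(2,3)]], rule halts_in_Seq)
    fix s2 assume s2: "agree s1 s2 \<and> reg s2 num_vars = eval n a s1"
    have eq: "reg s2 \<circ> var_reg = reg s1 \<circ> var_reg"
      using s2 by (auto simp: agree_def)
    show "halts_in (comp_exp var_reg (num_vars + 1) e) s2 (poly (exp_time e) n)
      (evaluates (num_vars + 1) (ev n e (reg s2 \<circ> var_reg) (mem s2)) s2)"
      by (rule comp_exp_correct) (use s2 Store.prems in \<open>auto simp: agree_def less_Suc_eq\<close>)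
    fix s3 assume "evaluates (num_vars + 1) (ev n e (reg s2 \<circ> var_reg) (mem s2)) s2 s3"
    then show "halts_in (Instr (STORE num_vars (num_vars + 1))) s3 1
      (agree (den n (Store a e) s1))"
      using s2 unfolding eq by (intro halts_in_Instr) (auto simp: agree_def evaluates_def)
  qed
  then show ?case
    by (simp only: cmd_time.simps poly_add poly_1 add.assoc)
next
  case (Output e)
  have "halts_in (comp_cmd (Output e)) s (poly (exp_time e) n + 1)
    (agree (den n (Output e) s1))"
    unfolding comp_cmd.simps
    by (rule halts_in_Seq[OF comp_var_exp_correct[OF Output.prems(2,3)]], rule halts_in_Instr)
      (auto simp: agree_def)
  then show ?case by simp
next
  case (CSeq c d)
  have c: "wf_cmd c" and d: "wf_cmd d" using CSeq.prems by auto
  have "reg (den n c s1) 0 = n"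
    using den_unassigned[OF zero_unassigned[OF c]] CSeq.prems by simp
  with CSeq.IH(1)[OF c CSeq.prems(2,3)] CSeq.IH(2)[OF d] show ?case
    by (auto intro: halts_in_Seq)
next
  case (CIf e c d)
  have "halts_in (comp_cmd (CIf e c d)) s
    (poly (exp_time e) n + (1 + (poly (cmd_time c) n + poly (cmd_time d) n)))
    (agree (den n (CIf e c d) s1))"
    unfolding comp_cmd.simps
    by (rule halts_in_Seq[OF comp_var_exp_correct[OF CIf.prems(2,3)]], rule halts_in_Cond)
      (use CIf in auto)
  then show ?case by (simp add: algebra_simps)
next
  case (For x c)
  define g where "g m = fold (\<lambda>j s. den n c (set_reg x j s)) [0..<m] s1" for m
  have wf: "0 < x" "x < num_vars" "x \<notin> assigned c" "wf_cmd c" using For.prems by auto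
  have g0: "reg (g m) 0 = n" for m
    by (induction m)
      (use den_unassigned[OF zero_unassigned[OF wf(4)]] wf For.prems in \<open>auto simp: g_def\<close>)
  \<comment> \<open>With \<open>m\<close> rounds left the counter stands at \<open>n - m\<close>,
    already incremented, and \<open>num_vars\<close> holds the difference that the loop
    tests.\<close>
  define Inv where "Inv m s' \<longleftrightarrow> m \<le> n \<and> reg s' num_vars = m \<and>
    agree (set_reg x (n - m) (g (n - m))) s'" for m s'
  have body: "halts_in (for_body x (comp_cmd c)) s2
    (poly (cmd_time c) n + Suc (Suc 1)) (Inv m)" if s2: "Inv (Suc m) s2" for m s2
    unfolding for_body_def
  proof (rule halts_in_Seq[OF For.IH[OF wf(4)]])
    let ?j = "n - Suc m"
    show "agree (set_reg x ?j (g ?j)) s2" using s2 by (simp add: Inv_def)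
    show "reg (set_reg x ?j (g ?j)) 0 = n" using g0 wf by simp
    have m: "n - m = Suc ?j" "Suc m \<le> n" using s2 by (auto simp: Inv_def)
    have gS: "g (n - m) = den n c (set_reg x ?j (g ?j))" by (simp add: m g_def)
    fix s3 assume s3: "agree (den n c (set_reg x ?j (g ?j))) s3"
    have "reg s3 x = ?j" "reg s3 0 = n"
      using s3 wf den_unassigned[OF wf(3)] g0[of "n - m"] by (auto simp: agree_def gS)
    then show "halts_in (Seq (Instr (SET num_vars 1)) (Seq (Instr (ADD x x num_vars))
      (Instr (SUB num_vars 0 x)))) s3 (Suc (Suc 1)) (Inv m)"
      using s3 m wf unfolding gS[symmetric]
      by (intro halts_in_Instr_Seq halts_in_Instr) (auto simp: Inv_def agree_def)
  qed
  define s0 where "s0 = exec (SUB num_vars 0 x) (exec (SET x 0) s)"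
  have "Inv n s0"
    using For.prems by (auto simp: Inv_def s0_def agree_def g_def)
  from halts_in_Loop[of Inv, OF body _ this]
  have "halts_in (Loop num_vars (for_body x (comp_cmd c))) s0
    (n * (poly (cmd_time c) n + Suc (Suc 1) + 1) + 1) (Inv 0)"
    by (auto simp: Inv_def)
  then have "halts_in (comp_cmd (For x c)) s
    (Suc (Suc (n * (poly (cmd_time c) n + Suc (Suc 1) + 1) + 1))) (Inv 0)"
    unfolding comp_cmd.simps s0_def by (intro halts_in_Instr_Seq)
  then show ?case
    by (rule halts_in_mono) (auto simp: Inv_def g_def algebra_simps)
qed

section \<open>The enumeration program\<close>

text \<open>
  Variables: 0 holds \<open>n\<close>, 1 the first address above the stack, 2 the address of the block being
  processed, 3 its level \<open>i\<close>, 4 the address of row \<open>i\<close> of the adjacency matrix, 5 a loop index;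
  6 to 8 are bound in sums. A block is the characteristic vector of a set (\<open>n\<close> cells) followed by
  the set's level. The stack starts right after the input, at address \<open>1 + n * n\<close>.
\<close>

definition row_start :: "exp \<Rightarrow> exp" where
  "row_start e = Plus (Const 1) (SumE 8 e)"

definition nbr_test :: exp where
  "nbr_test = SumE 7 (IfE (Mem (Plus (Var 2) (Var 7))) (Mem (Plus (Var 4) (Var 7))) (Const 0))"

text \<open>Variable 6 is the vertex \<open>u\<close> to be dominated, 7 the candidate
  \<open>w\<close>; the truncated difference is positive exactly if \<open>w < u\<close>.\<close>

definition witness_test :: exp where
  "witness_test = SumE 7 (IfE (Mem (Plus (Var 2) (Var 7)))
     (IfE (Mem (Plus (row_start (Var 6)) (Var 7)))
       (IfE (Mem (Plus (Var 4) (Var 7)))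
         (IfE (Mem (Plus (Var 4) (Var 6))) (Minus (Var 6) (Var 7)) (Const 0))
         (Const 1))
       (Const 0))
     (Const 0))"

text \<open>The negation is tested because it is existential, so that a nonzero sum expresses
  it.\<close>

definition noncanonical_test :: exp where
  "noncanonical_test = SumE 6 (IfE (Minus (Var 3) (Var 6))
     (IfE (Mem (Plus (Var 2) (Var 6))) (Const 0) (IfE witness_test (Const 0) (Const 1)))
     (Const 0))"

definition swap_loop :: cmd where
  "swap_loop = Store (Plus (Var 1) (Var 5))
     (IfE (Mem (Plus (Var 4) (Var 5))) (Const 0) (Mem (Plus (Var 2) (Var 5))))"

text \<open>If \<open>retain\<close> has dropped the current block, \<open>push_swap\<close> overwrites that block in place.\<close>

definition push_swap :: cmd where
  "push_swap = CSeq (For 5 swap_loop)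
     (CSeq (Store (Plus (Var 1) (Var 3)) (Const 1))
     (CSeq (Store (Plus (Var 1) (Var 0)) (Plus (Var 3) (Const 1)))
       (Assign 1 (Plus (Var 1) (Plus (Var 0) (Const 1))))))"

text \<open>Whether the block is kept or popped, its \<open>n\<close> membership cells stay intact
  for \<open>push_swap\<close> to read.\<close>

definition retain :: cmd where
  "retain = CIf nbr_test
     (Store (Plus (Var 2) (Var 0)) (Plus (Var 3) (Const 1)))
     (Assign 1 (Var 2))"

definition expand :: cmd where
  "expand = CSeq (Assign 4 (row_start (Var 3)))
     (CIf noncanonical_test retain (CSeq retain push_swap))"

definition emit_loop :: cmd where
  "emit_loop = CIf (Mem (Plus (Var 2) (Var 5))) (Output (Plus (Var 5) (Const 1))) Skip"

definition emit :: cmd where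
  "emit = CSeq (Assign 1 (Var 2)) (CSeq (For 5 emit_loop) (Output (Const 0)))"

definition process_top :: cmd where
  "process_top = CSeq (Assign 2 (Minus (Var 1) (Plus (Var 0) (Const 1))))
     (CSeq (Assign 3 (Mem (Plus (Var 2) (Var 0))))
       (CIf (Minus (Var 0) (Var 3)) expand emit))"

text \<open>Memory above the input is 0, so the block of the empty set at level 0 is already there.\<close>

definition push_root :: cmd where
  "push_root = Assign 1 (Plus (row_start (Var 0)) (Plus (Var 0) (Const 1)))"

text \<open>Counts cells instead of blocks, which avoids a division; zero still means an empty
  stack.\<close>

definition stack_size :: exp where
  "stack_size = Minus (Var 1) (row_start (Var 0))"

text \<open>Register 0 starts at 0 and address 0 holds \<open>n\<close>, so the first instruction
  loads \<open>n\<close>.\<close>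

definition mis_prog :: prog where
  "mis_prog = Seq (Instr (LOAD 0 0)) (Seq (comp_cmd push_root) (Seq (comp_var_exp stack_size)
     (Loop num_vars (Seq (comp_cmd process_top) (comp_var_exp stack_size)))))"

lemma var_reg_numeral [simp]:
  "var_reg 0 = 0" "var_reg (Suc 0) = 1" "var_reg 2 = 2" "var_reg 3 = 3" "var_reg 4 = 4" "var_reg 5 = 5"
  by (auto simp: var_reg_def num_vars_def)

text \<open>Summing a constant over \<open>n\<close> indices multiplies it by \<open>n\<close>;
  variable 8 is the one bound by that sum.\<close>

lemma ev_row_start [simp]:
  "x \<noteq> 8 \<Longrightarrow> ev n (row_start (Var x)) \<rho> \<mu> = 1 + n * \<rho> x"
  by (simp add: row_start_def)

lemma ev_SumE_nonzero:
  assumes "\<And>j. j < n \<Longrightarrow> ev n e (\<rho>(x := j)) \<mu> \<noteq> 0 \<longleftrightarrow> P j"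
  shows "ev n (SumE x e) \<rho> \<mu> \<noteq> 0 \<longleftrightarrow> (\<exists>j<n. P j)"
  using assms unfolding ev.simps(7) sum_eq_0_iff[OF finite_lessThan] by blast

section \<open>The graph and the stack in memory\<close>

context fin_graph
begin

definition input_rep :: "(nat \<Rightarrow> nat) \<Rightarrow> bool" where
  "input_rep \<mu> \<longleftrightarrow> (\<forall>u<n. \<forall>w<n. \<mu> (1 + n * u + w) = (if adj u w then 1 else 0))"

definition set_rep :: "(nat \<Rightarrow> nat) \<Rightarrow> nat \<Rightarrow> nat set \<Rightarrow> bool" where
  "set_rep \<mu> a I \<longleftrightarrow> (\<forall>j<n. \<mu> (a + j) = (if j \<in> I then 1 else 0))"

definition block_rep :: "(nat \<Rightarrow> nat) \<Rightarrow> nat \<Rightarrow> nat \<times> nat set \<Rightarrow> bool" where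
  "block_rep \<mu> a p \<longleftrightarrow> set_rep \<mu> a (snd p) \<and> \<mu> (a + n) = fst p"

definition block_addr :: "nat \<Rightarrow> nat" where
  "block_addr m = 1 + n * n + m * (n + 1)"

text \<open>The last list element is the top. Maximality in the prefix is carried along for the
  lemmas on children.\<close>

definition stack_rep :: "(nat \<Rightarrow> nat) \<Rightarrow> (nat \<times> nat set) list \<Rightarrow> bool" where
  "stack_rep \<mu> st \<longleftrightarrow> input_rep \<mu> \<and> (\<forall>m<length st. block_rep \<mu> (block_addr m) (st ! m)) \<and>
     (\<forall>(i, I) \<in> set st. i \<le> n \<and> prefix_mis i I)"

definition rep :: "state \<Rightarrow> (nat \<times> nat set) list \<Rightarrow> bool" where
  "rep s st \<longleftrightarrow> reg s 0 = n \<and> reg s 1 = block_addr (length st) \<and> stack_rep (mem s) st"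

lemma row_bound: "u < n \<Longrightarrow> w < n \<Longrightarrow> n * u + w < n * n"
proof -
  assume "u < n" "w < n"
  then have "n * u + w < n * Suc u" by simp
  also have "\<dots> \<le> n * n" using \<open>u < n\<close> by (intro mult_le_mono2) simp
  finally show ?thesis .
qed

lemma input_rep_cong:
  assumes "input_rep \<mu>" "\<And>a. a < 1 + n * n \<Longrightarrow> \<mu>' a = \<mu> a"
  shows "input_rep \<mu>'"
  using assms row_bound by (simp add: input_rep_def)

lemma block_addr_add_le: "m < m' \<Longrightarrow> block_addr m + n < block_addr m'"
proof -
  assume "m < m'"
  then have "Suc m * (n + 1) \<le> m' * (n + 1)" by (intro mult_le_mono1) simp
  then show ?thesis by (simp add: block_addr_def)
qed

lemma stack_rep_cong:
  assumes "stack_rep \<mu> st" "\<And>a. a < block_addr (length st) \<Longrightarrow> \<mu>' a = \<mu> a"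
  shows "stack_rep \<mu>' st"
  unfolding stack_rep_def
proof (intro conjI allI impI)
  have "1 + n * n \<le> block_addr (length st)" by (simp add: block_addr_def)
  then have "\<mu>' a = \<mu> a" if "a < 1 + n * n" for a
    using assms(2) that order_less_le_trans by blast
  then show "input_rep \<mu>'"
    using assms(1) input_rep_cong unfolding stack_rep_def by blast
  show "\<forall>(i, I) \<in> set st. i \<le> n \<and> prefix_mis i I"
    using assms(1) unfolding stack_rep_def by blast
  fix m assume m: "m < length st"
  have eq: "\<mu>' (block_addr m + j) = \<mu> (block_addr m + j)" if "j \<le> n" for j
    using block_addr_add_le[OF m] that by (intro assms(2)) linarith
  have "block_rep \<mu> (block_addr m) (st ! m)"
    using assms(1) m unfolding stack_rep_def by blast
  then show "block_rep \<mu>' (block_addr m) (st ! m)"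
    unfolding block_rep_def set_rep_def by (simp add: eq)
qed

lemma stack_rep_snoc:
  "stack_rep \<mu> (st @ [(i, I)]) \<longleftrightarrow>
     stack_rep \<mu> st \<and> block_rep \<mu> (block_addr (length st)) (i, I) \<and> i \<le> n \<and> prefix_mis i I"
  by (auto simp: stack_rep_def nth_append less_Suc_eq)

text \<open>Leaves the stack top and the level cell \<open>b + n\<close> open, so that it survives
  \<open>retain\<close>.\<close>

definition frame :: "state \<Rightarrow> nat \<Rightarrow> nat \<Rightarrow> nat set \<Rightarrow> bool" where
  "frame s b i I \<longleftrightarrow> reg s 0 = n \<and> reg s 2 = b \<and> reg s 3 = i \<and> reg s 4 = 1 + n * i \<and>
     1 + n * n \<le> b \<and> i < n \<and> I \<subseteq> {..<i} \<and> input_rep (mem s) \<and> set_rep (mem s) b I"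

lemma frame_cells:
  assumes "frame s b i I"
  shows "reg s 0 = n" "reg s 2 = b" "reg s 3 = i" "reg s 4 = Suc (n * i)"
    "j < n \<Longrightarrow> mem s (b + j) = (if j \<in> I then 1 else 0)"
    "j < n \<Longrightarrow> mem s (Suc (n * i + j)) = (if adj i j then 1 else 0)"
    "u < n \<Longrightarrow> j < n \<Longrightarrow> mem s (Suc (n * u + j)) = (if adj u j then 1 else 0)"
  using assms by (simp_all add: frame_def input_rep_def set_rep_def)

section \<open>Correctness of the tests\<close>

lemma eval_nbr_test:
  assumes "frame s b i I"
  shows "eval n nbr_test s \<noteq> 0 \<longleftrightarrow> has_nbr i I"
proof -
  have "eval n nbr_test s \<noteq> 0 \<longleftrightarrow> (\<exists>w<n. w \<in> I \<and> adj i w)"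
    unfolding nbr_test_def
    by (rule ev_SumE_nonzero) (simp add: frame_cells[OF assms])
  then show ?thesis unfolding has_nbr_def by (meson adj_less(2))
qed

lemma ev_witness_test:
  assumes "frame s b i I" "u < n"
  shows "ev n witness_test ((reg s \<circ> var_reg)(6 := u)) (mem s) \<noteq> 0 \<longleftrightarrow>
    (\<exists>w\<in>I. adj u w \<and> (\<not> adj i w \<or> (w < u \<and> adj i u)))"
proof -
  have "ev n witness_test ((reg s \<circ> var_reg)(6 := u)) (mem s) \<noteq> 0 \<longleftrightarrow>
    (\<exists>w<n. w \<in> I \<and> adj u w \<and> (\<not> adj i w \<or> (w < u \<and> adj i u)))"
    unfolding witness_test_def
    by (rule ev_SumE_nonzero) (simp add: frame_cells[OF assms(1)] assms(2))
  then show ?thesis by (meson adj_less(2))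
qed

lemma eval_noncanonical_test:
  assumes "frame s b i I"
  shows "eval n noncanonical_test s \<noteq> 0 \<longleftrightarrow> \<not> canonical i I"
proof -
  have "eval n noncanonical_test s \<noteq> 0 \<longleftrightarrow>
      (\<exists>u<n. u < i \<and> u \<notin> I \<and> \<not> (\<exists>w\<in>I. adj u w \<and> (\<not> adj i w \<or> (w < u \<and> adj i u))))"
    unfolding noncanonical_test_def
  proof (rule ev_SumE_nonzero)
    fix u assume "u < n"
    then show "ev n (IfE (Minus (Var 3) (Var 6))
        (IfE (Mem (Plus (Var 2) (Var 6))) (Const 0) (IfE witness_test (Const 0) (Const 1)))
        (Const 0)) ((reg s \<circ> var_reg)(6 := u)) (mem s) \<noteq> 0 \<longleftrightarrow>
      u < i \<and> u \<notin> I \<and> \<not> (\<exists>w\<in>I. adj u w \<and> (\<not> adj i w \<or> (w < u \<and> adj i u)))"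
      using ev_witness_test[OF assms \<open>u < n\<close>] by (simp add: frame_cells[OF assms])
  qed
  moreover have "i < n" using assms by (simp add: frame_def)
  ultimately show ?thesis
    unfolding canonical_def by (meson order_less_trans)
qed

section \<open>Effect of the commands on the stack\<close>

text \<open>Overwriting in place (\<open>a = b\<close>) is safe: round \<open>m\<close> reads the
  set only at cell \<open>m\<close>, which no earlier round has written.\<close>

lemma swap_loop_fold:
  assumes s: "frame s b i I" and top: "reg s 1 = a" "a = b \<or> b + n < a" and "m \<le> n"
  defines "s' \<equiv> fold (\<lambda>j s. den n swap_loop (set_reg 5 j s)) [0..<m] s"
  shows "out s' = out s \<and> (\<forall>r. r \<noteq> 5 \<longrightarrow> reg s' r = reg s r) \<and>
    mem s' = (\<lambda>x. if a \<le> x \<and> x < a + m then if x - a \<in> I \<and> \<not> adj i (x - a) then 1 else 0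
      else mem s x)"
  using \<open>m \<le> n\<close> unfolding s'_def
proof (induction m)
  case (Suc m)
  define s1 where "s1 = fold (\<lambda>j s. den n swap_loop (set_reg 5 j s)) [0..<m] s"
  have s1: "out s1 = out s" "\<And>r. r \<noteq> 5 \<Longrightarrow> reg s1 r = reg s r"
    "mem s1 = (\<lambda>x. if a \<le> x \<and> x < a + m then if x - a \<in> I \<and> \<not> adj i (x - a) then 1 else 0
      else mem s x)"
    using Suc.IH[OF Suc_leD[OF Suc.prems]] unfolding s1_def by blast+
  have "n * i + m < n * n" using row_bound[of i m] s Suc.prems by (simp add: frame_def)
  moreover have "1 + n * n \<le> a" using s top by (auto simp: frame_def)
  ultimately have "mem s1 (1 + n * i + m) = mem s (1 + n * i + m)" by (simp add: s1)
  then have row: "mem s1 (1 + n * i + m) = (if adj i m then 1 else 0)"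
    using s Suc.prems by (simp add: frame_def input_rep_def)
  have "mem s1 (b + m) = mem s (b + m)" using top(2) Suc.prems by (auto simp: s1)
  then have set: "mem s1 (b + m) = (if m \<in> I then 1 else 0)"
    using s Suc.prems by (simp add: frame_def set_rep_def)
  define s2 where "s2 = den n swap_loop (set_reg 5 m s1)"
  have "reg s1 1 = a" "reg s1 2 = b" "reg s1 4 = 1 + n * i"
    using s top(1) s1(2) by (simp_all add: frame_def)
  then have "mem s2 = (mem s1)(a + m := if m \<in> I \<and> \<not> adj i m then 1 else 0)"
    using row set by (simp add: s2_def swap_loop_def)
  moreover have "out s2 = out s1" "reg s2 = (reg s1)(5 := m)"
    by (simp_all add: s2_def swap_loop_def)
  moreover have "fold (\<lambda>j s. den n swap_loop (set_reg 5 j s)) [0..<Suc m] s = s2"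
    by (simp add: s1_def s2_def)
  ultimately show ?case by (auto simp: s1 fun_eq_iff)
qed auto

lemma den_push_swap:
  assumes s: "frame s b i I" and top: "reg s 1 = a" "a = b \<or> b + n < a"
  defines "s' \<equiv> den n push_swap s"
  shows "out s' = out s" "reg s' 0 = n" "reg s' 1 = a + n + 1"
    "\<And>x. x < a \<Longrightarrow> mem s' x = mem s x" "block_rep (mem s') a (Suc i, swap i I)"
proof -
  define f where "f = fold (\<lambda>j s. den n swap_loop (set_reg 5 j s)) [0..<n] s"
  have f: "out f = out s" "\<And>r. r \<noteq> 5 \<Longrightarrow> reg f r = reg s r"
    "\<And>x. x < a \<Longrightarrow> mem f x = mem s x"
    "\<And>j. j < n \<Longrightarrow> mem f (a + j) = (if j \<in> I \<and> \<not> adj i j then 1 else 0)"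
    using swap_loop_fold[OF s top order_refl] unfolding f_def by simp_all
  have regs: "reg f 0 = n" "reg f 1 = a" "reg f 3 = i" "i < n"
    using s top(1) by (auto simp: f(2) frame_def)
  have For: "den n (For 5 swap_loop) s = set_reg 5 n f"
    by (simp add: f_def)
  have "out s' = out f" "mem s' = (mem f)(a + i := 1, a + n := Suc i)"
    "reg s' 0 = n" "reg s' 1 = a + n + 1"
    using regs by (simp_all add: s'_def push_swap_def For del: den.simps(7))
  note s' = this
  show "out s' = out s" "reg s' 0 = n" "reg s' 1 = a + n + 1"
    by (simp_all only: s' f(1))
  show "mem s' x = mem s x" if "x < a" for x
    using that by (simp add: s'(2) f(3))
  have "mem s' (a + j) = (if j \<in> swap i I then 1 else 0)" if "j < n" for j
    using that by (simp add: s'(2) f(4) swap_def)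
  then show "block_rep (mem s') a (Suc i, swap i I)"
    by (simp add: block_rep_def set_rep_def s'(2))
qed

lemma den_retain:
  assumes s: "frame s b i I" and top: "reg s 1 = b + n + 1"
  defines "s' \<equiv> den n retain s"
  shows "out s' = out s" "frame s' b i I" "\<And>x. x < b \<Longrightarrow> mem s' x = mem s x"
    "has_nbr i I \<Longrightarrow> reg s' 1 = b + n + 1 \<and> block_rep (mem s') b (Suc i, I)"
    "\<not> has_nbr i I \<Longrightarrow> reg s' 1 = b"
proof -
  have regs: "reg s 0 = n" "reg s 2 = b" "reg s 3 = i" using s by (auto simp: frame_def)
  define s1 where "s1 = s\<lparr>mem := (mem s)(b + n := Suc i)\<rparr>"
  have s': "s' = (if has_nbr i I then s1 else set_reg 1 b s)"
    using eval_nbr_test[OF s] regs by (simp add: s'_def retain_def s1_def)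
  have b: "1 + n * n \<le> b" and inp: "input_rep (mem s)" using s by (auto simp: frame_def)
  have "input_rep (mem s1)"
    by (rule input_rep_cong[OF inp]) (use b in \<open>simp add: s1_def\<close>)
  then have "frame s1 b i I" "block_rep (mem s1) b (Suc i, I)"
    using s by (simp_all add: s1_def frame_def set_rep_def block_rep_def)
  moreover have "frame (set_reg 1 b s) b i I"
    using s by (simp add: frame_def)
  ultimately show "frame s' b i I"
    "has_nbr i I \<Longrightarrow> reg s' 1 = b + n + 1 \<and> block_rep (mem s') b (Suc i, I)"
    using top by (simp_all add: s' s1_def)
  show "out s' = out s" "\<not> has_nbr i I \<Longrightarrow> reg s' 1 = b"
    by (simp_all add: s' s1_def)
  show "mem s' x = mem s x" if "x < b" for x
    using that by (simp add: s' s1_def)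
qed

lemma block_addr_Suc: "block_addr (Suc m) = block_addr m + n + 1"
  by (simp add: block_addr_def)

text \<open>The children appear reversed because the end of the list is the top: the swapped set is
  pushed last and processed first.\<close>

lemma den_expand:
  assumes rep: "rep s (st @ [(i, I)])" and i: "i < n"
    and regs: "reg s 2 = block_addr (length st)" "reg s 3 = i"
  defines "s' \<equiv> den n expand s"
  shows "out s' = out s" "rep s' (st @ map (Pair (Suc i)) (rev (children i I)))"
proof -
  let ?b = "block_addr (length st)"
  have st: "stack_rep (mem s) st" and blk: "block_rep (mem s) ?b (i, I)" and I: "prefix_mis i I"
    and n: "reg s 0 = n" and top: "reg s 1 = ?b + n + 1"
    using rep by (simp_all add: rep_def stack_rep_snoc block_addr_Suc)
  define s1 where "s1 = den n (Assign 4 (row_start (Var 3))) s"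
  have mem: "mem s1 = mem s" and out: "out s1 = out s" and reg: "reg s1 = (reg s)(4 := 1 + n * i)"
    by (simp_all add: s1_def regs)
  have "1 + n * n \<le> ?b" by (simp add: block_addr_def)
  moreover have "I \<subseteq> {..<i}" using I unfolding prefix_mis_def by blast
  moreover have "input_rep (mem s)" using st unfolding stack_rep_def by blast
  ultimately have s1: "frame s1 ?b i I"
    using blk n regs i by (simp add: frame_def mem reg block_rep_def)
  have top1: "reg s1 1 = ?b + n + 1" using top by (simp add: reg)
  define s2 where "s2 = den n retain s1"
  note s2 = den_retain[OF s1 top1, folded s2_def]
  have st2: "stack_rep (mem s2) st"
    by (rule stack_rep_cong[OF st]) (simp add: s2(3) mem)
  have n2: "reg s2 0 = n" using s2(2) unfolding frame_def by blast
  have child: "prefix_mis (Suc i) X" if "X \<in> set (children i I)" for X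
    using children_prefix_mis[OF I that] .
  define kept where "kept = (if has_nbr i I then [(Suc i, I)] else [])"
  have rep2: "rep s2 (st @ kept)"
  proof (cases "has_nbr i I")
    case True
    then have "prefix_mis (Suc i) I" by (intro child) (simp add: children_def)
    with True show ?thesis
      using s2(4) st2 n2 i by (simp add: rep_def kept_def stack_rep_snoc block_addr_Suc)
  next
    case False
    then show ?thesis using s2(5) st2 n2 by (simp add: rep_def kept_def)
  qed
  have s': "s' = (if canonical i I then den n push_swap s2 else s2)"
    using eval_noncanonical_test[OF s1] by (simp add: s'_def expand_def s2_def s1_def)
  have "out s' = out s \<and> rep s' (st @ map (Pair (Suc i)) (rev (children i I)))"
  proof (cases "canonical i I")
    case False
    then have "s' = s2" "kept = map (Pair (Suc i)) (rev (children i I))"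
      by (simp_all add: s' kept_def children_def)
    then show ?thesis using rep2 s2(1) out by simp
  next
    case True
    \<comment> \<open>This is \<open>?b\<close> if the block was dropped and the address directly
      above it otherwise, the two cases of \<open>den_push_swap\<close>.\<close>
    define a where "a = block_addr (length (st @ kept))"
    have a: "reg s2 1 = a" "a = ?b \<or> ?b + n < a"
      using rep2 by (simp_all add: rep_def a_def kept_def block_addr_Suc)
    note s3 = den_push_swap[OF s2(2) a]
    have st3: "stack_rep (mem (den n push_swap s2)) (st @ kept)"
      by (rule stack_rep_cong[of "mem s2"])
        (use rep2 s3(4) in \<open>simp_all add: rep_def a_def del: length_append\<close>)
    have "prefix_mis (Suc i) (swap i I)"
      using True by (intro child) (simp add: children_def)
    moreover have "block_addr (length ((st @ kept) @ [(Suc i, swap i I)])) = a + n + 1"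
      by (simp add: a_def block_addr_Suc)
    ultimately have "rep (den n push_swap s2) ((st @ kept) @ [(Suc i, swap i I)])"
      unfolding rep_def stack_rep_snoc using st3 s3(2,3,5) i unfolding a_def[symmetric] by simp
    moreover have "(st @ kept) @ [(Suc i, swap i I)] = st @ map (Pair (Suc i)) (rev (children i I))"
      using True by (simp add: children_def kept_def)
    ultimately show ?thesis using True s' s2(1) s3(1) out by simp
  qed
  then show "out s' = out s" "rep s' (st @ map (Pair (Suc i)) (rev (children i I)))"
    by blast+
qed

lemma emit_loop_fold:
  assumes "reg s 2 = b" "set_rep (mem s) b I" "m \<le> n"
  defines "s' \<equiv> fold (\<lambda>j s. den n emit_loop (set_reg 5 j s)) [0..<m] s"
  shows "mem s' = mem s \<and> (\<forall>r. r \<noteq> 5 \<longrightarrow> reg s' r = reg s r) \<and>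
    out s' = out s @ map Suc (filter (\<lambda>j. j \<in> I) [0..<m])"
  using assms(1-3) unfolding s'_def
  by (induction m) (auto simp: emit_loop_def set_rep_def)

lemma den_emit:
  assumes rep: "rep s (st @ [(n, I)])" and regs: "reg s 2 = block_addr (length st)"
  defines "s' \<equiv> den n emit s"
  shows "out s' = out s @ encode_set I" "rep s' st"
proof -
  have I: "I \<subseteq> {..<n}" "set_rep (mem s) (block_addr (length st)) I"
    using rep by (auto simp: rep_def stack_rep_snoc prefix_mis_def block_rep_def)
  \<comment> \<open>The loop prints in increasing order, which is the order of
    \<open>sorted_list_of_set\<close>.\<close>
  have "I = set (filter (\<lambda>j. j \<in> I) [0..<n])" using I(1) by auto
  moreover have "sorted (filter (\<lambda>j. j \<in> I) [0..<n])"
    using sorted_filter[of "\<lambda>x. x" "[0..<n]"] by simp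
  ultimately have "sorted_list_of_set I = filter (\<lambda>j. j \<in> I) [0..<n]"
    by (metis distinct_filter distinct_upt sorted_list_of_set.idem_if_sorted_distinct)
  then show "out s' = out s @ encode_set I" "rep s' st"
    using emit_loop_fold[of "set_reg 1 (block_addr (length st)) s", OF _ _ order_refl] rep regs I(2)
    by (auto simp: s'_def emit_def encode_set_def rep_def stack_rep_snoc)
qed

lemma den_process_top:
  assumes rep: "rep s (st @ [(i, I)])"
  defines "s' \<equiv> den n process_top s"
  shows "i < n \<Longrightarrow> out s' = out s \<and> rep s' (st @ map (Pair (Suc i)) (rev (children i I)))"
    and "i = n \<Longrightarrow> out s' = out s @ encode_set I \<and> rep s' st"
proof -
  define s1 where "s1 = den n (CSeq (Assign 2 (Minus (Var 1) (Plus (Var 0) (Const 1))))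
    (Assign 3 (Mem (Plus (Var 2) (Var 0))))) s"
  have s1: "reg s1 2 = block_addr (length st)" "reg s1 3 = i" "out s1 = out s"
    "rep s1 (st @ [(i, I)])"
    using rep by (auto simp: s1_def rep_def stack_rep_snoc block_rep_def block_addr_Suc)
  have n: "reg s1 0 = n" using s1 by (simp add: rep_def)
  have s': "s' = (if i < n then den n expand s1 else den n emit s1)"
    using s1(2) n by (simp add: s'_def process_top_def s1_def)
  show "i < n \<Longrightarrow> out s' = out s \<and> rep s' (st @ map (Pair (Suc i)) (rev (children i I)))"
    using den_expand[OF s1(4)] s1 s' by simp
  show "i = n \<Longrightarrow> out s' = out s @ encode_set I \<and> rep s' st"
    using den_emit[of s1 st I] s1 s' by simp
qed

section \<open>Invariant and running time of the traversal\<close>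

text \<open>The sets still to be printed, from the top of the stack down, hence
  \<open>rev\<close>.\<close>

definition pending :: "(nat \<times> nat set) list \<Rightarrow> nat set list" where
  "pending st = concat (map (\<lambda>(i, I). leaves (n - i) I) (rev st))"

text \<open>The number of tree nodes still to be visited; each round visits one, so it serves as the
  loop index.\<close>

definition work :: "(nat \<times> nat set) list \<Rightarrow> nat" where
  "work st = sum_list (map (\<lambda>(i, I). tree_size (n - i) I) st)"

lemma pending_expand:
  assumes "i < n"
  shows "pending (st @ map (Pair (Suc i)) (rev (children i I))) = pending (st @ [(i, I)])"
proof -
  have "n - i = Suc (n - Suc i)" "n - Suc (n - Suc i) = i" using assms by auto
  then show ?thesis by (simp add: pending_def rev_map comp_def)
qed

lemma work_expand:
  assumes "i < n"
  shows "work (st @ [(i, I)]) = Suc (work (st @ map (Pair (Suc i)) (rev (children i I))))"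
proof -
  have "n - i = Suc (n - Suc i)" "n - Suc (n - Suc i) = i" using assms by auto
  then show ?thesis by (simp add: work_def comp_def rev_map[symmetric] sum_list_rev)
qed

lemma tree_size_pos: "0 < tree_size k I"
  by (cases k) auto

text \<open>Each block counts at least one node; this ties the loop index to the test for an empty
  stack.\<close>

lemma work_eq_0: "work st = 0 \<longleftrightarrow> st = []"
  by (cases st) (auto simp: work_def tree_size_pos split: prod.splits)

lemma eval_stack_size: "rep s st \<Longrightarrow> eval n stack_size s = length st * (n + 1)"
  by (simp add: stack_size_def rep_def block_addr_def)

lemma concat_rows_nth:
  assumes "u < m" "w < k"
  shows "concat (map (\<lambda>i. map (f i) [0..<k]) [0..<m]) ! (k * u + w) = f u w"
  using assms
proof (induction m)
  case (Suc m)
  have len: "length (concat (map (\<lambda>i. map (f i) [0..<k]) [0..<m])) = k * m"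
    by (induction m) auto
  show ?case
  proof (cases "u < m")
    case True
    have "k * u + w < k * Suc u" using Suc.prems by simp
    also have "\<dots> \<le> k * m" using True by (intro mult_le_mono2) simp
    finally show ?thesis using Suc True len by (simp add: nth_append)
  next
    case False
    with Suc.prems have "u = m" by simp
    then show ?thesis using Suc.prems len by (simp add: nth_append)
  qed
qed simp

lemma length_graph_input: "length (graph_input n E) = 1 + n * n"
proof -
  have "length (concat (map (\<lambda>i. map (f i) [0..<n]) [0..<m])) = m * n" for m and f :: "nat \<Rightarrow> nat \<Rightarrow> nat"
    by (induction m) auto
  then show ?thesis by (simp add: graph_input_def)
qed

lemma rep_root:
  assumes "reg s 0 = n" "mem s = mem (start_state (graph_input n E))"
  shows "rep (den n push_root s) [(0, {})]"
proof -
  have "input_rep (mem s)"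
    using assms(2) row_bound concat_rows_nth[of _ n _ n "\<lambda>u w. if {u, w} \<in> E then 1 else (0::nat)"]
    unfolding input_rep_def start_state_def
    by (auto simp: length_graph_input adj_def) (auto simp: graph_input_def)
  moreover have "mem s (1 + n * n + j) = 0" for j
    using assms(2) by (simp add: start_state_def length_graph_input)
  ultimately show ?thesis
    using assms(1)
    by (auto simp: rep_def push_root_def stack_rep_def block_rep_def set_rep_def block_addr_def
        prefix_mis_def stable_def)
qed

lemma wf_process_top: "wf_cmd process_top" and wf_push_root: "wf_cmd push_root"
  by (auto simp: process_top_def push_root_def expand_def retain_def push_swap_def swap_loop_def
      emit_def emit_loop_def num_vars_def)

text \<open>The output so far followed by the pending sets is always the full list, and every round
  removes one node from the remaining work, which starts at \<open>tree_size n {}\<close>.\<close>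

lemma mis_prog_halts:
  "halts_in mis_prog (start_state (graph_input n E))
    (1 + (poly (cmd_time push_root) n + (poly (exp_time stack_size) n +
      (tree_size n {} * (poly (cmd_time process_top) n + poly (exp_time stack_size) n + 1) + 1))))
    (\<lambda>s. out s = concat (map encode_set (level n)))"
proof -
  define Inv where "Inv m s' \<longleftrightarrow> (\<exists>s st. agree s s' \<and> rep s st \<and>
    reg s' num_vars = eval n stack_size s \<and> m = work st \<and>
    out s @ concat (map encode_set (pending st)) = concat (map encode_set (level n)))" for m s'
  have test: "reg s' num_vars = 0 \<longleftrightarrow> m = 0" if "Inv m s'" for m s'
    using that by (auto simp: Inv_def eval_stack_size work_eq_0)
  have n: "reg s 0 = n" if "rep s st" for s st using that by (simp add: rep_def)
  have body: "halts_in (Seq (comp_cmd process_top) (comp_var_exp stack_size)) s'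
    (poly (cmd_time process_top) n + poly (exp_time stack_size) n) (Inv m)"
    if "Inv (Suc m) s'" for m s'
  proof -
    from that obtain s st0 where s: "agree s s'" "rep s st0" "Suc m = work st0"
      "out s @ concat (map encode_set (pending st0)) = concat (map encode_set (level n))"
      by (auto simp: Inv_def)
    from s(3) have "st0 \<noteq> []" by (auto simp: work_def)
    then obtain st i I where st0: "st0 = st @ [(i, I)]"
      by (cases st0 rule: rev_cases) auto
    let ?s1 = "den n process_top s"
    have top: "rep s (st @ [(i, I)])" using s st0 by simp
    have "\<exists>st1. rep ?s1 st1 \<and> m = work st1 \<and>
      out ?s1 @ concat (map encode_set (pending st1)) = concat (map encode_set (level n))"
    proof (cases "i < n")
      case True
      with den_process_top(1)[OF top] s st0 work_expand[OF True] show ?thesis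
        by (intro exI[of _ "st @ map (Pair (Suc i)) (rev (children i I))"])
          (simp add: pending_expand)
    next
      case False
      moreover have "i \<le> n" using top by (simp add: rep_def stack_rep_snoc)
      ultimately have "i = n" by simp
      \<comment> \<open>At depth \<open>n\<close> the node is its own only leaf and has size 1, so
        printing and popping it keeps the invariant.\<close>
      with den_process_top(2)[OF top] s st0 show ?thesis
        by (intro exI[of _ st]) (auto simp: pending_def work_def)
    qed
    then obtain st1 where st1: "rep ?s1 st1" "m = work st1"
      "out ?s1 @ concat (map encode_set (pending st1)) = concat (map encode_set (level n))"
      by blast
    show ?thesis
    proof (rule halts_in_Seq[OF comp_cmd_correct[OF wf_process_top s(1) n[OF s(2)]]])
      fix s2 assume "agree ?s1 s2"
      from comp_var_exp_correct[OF this n[OF st1(1)]]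
      show "halts_in (comp_var_exp stack_size) s2 (poly (exp_time stack_size) n) (Inv m)"
        by (rule halts_in_mono) (use st1 in \<open>auto simp: Inv_def\<close>)
    qed
  qed
  let ?s0 = "start_state (graph_input n E)"
  let ?s1 = "exec (LOAD 0 0) ?s0"
  let ?s2 = "den n push_root ?s1"
  have s1: "reg ?s1 0 = n" "mem ?s1 = mem ?s0"
    by (simp_all add: start_state_def graph_input_def)
  have rep2: "rep ?s2 [(0, {})]" by (rule rep_root[OF s1])
  have out2: "out ?s2 = []" by (simp add: push_root_def start_state_def)
  show ?thesis
    unfolding mis_prog_def
  proof (rule halts_in_Seq[where P = "\<lambda>s. s = ?s1"], rule halts_in_Instr, rule refl)
    fix s assume s: "s = ?s1"
    show "halts_in (Seq (comp_cmd push_root) (Seq (comp_var_exp stack_size)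
        (Loop num_vars (Seq (comp_cmd process_top) (comp_var_exp stack_size))))) s
      (poly (cmd_time push_root) n + (poly (exp_time stack_size) n +
        (tree_size n {} * (poly (cmd_time process_top) n + poly (exp_time stack_size) n + 1) + 1)))
      (\<lambda>s. out s = concat (map encode_set (level n)))"
      unfolding s
    proof (rule halts_in_Seq[OF comp_cmd_correct[OF wf_push_root agree_refl s1(1)]])
      fix s' assume s': "agree ?s2 s'"
      show "halts_in (Seq (comp_var_exp stack_size)
          (Loop num_vars (Seq (comp_cmd process_top) (comp_var_exp stack_size)))) s'
        (poly (exp_time stack_size) n +
          (tree_size n {} * (poly (cmd_time process_top) n + poly (exp_time stack_size) n + 1) + 1))
        (\<lambda>s. out s = concat (map encode_set (level n)))"
      proof (rule halts_in_Seq[OF comp_var_exp_correct[OF s' n[OF rep2]]])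
        fix s'' assume "agree ?s2 s'' \<and> reg s'' num_vars = eval n stack_size ?s2"
        moreover have "work [(0, {})] = tree_size n {}" "pending [(0, {})] = level n"
          by (simp_all add: work_def pending_def leaves_root)
        ultimately have "Inv (tree_size n {}) s''"
          unfolding Inv_def using rep2 out2
          by (intro exI[of _ ?s2] exI[of _ "[(0, {})]"]) auto
        from halts_in_Loop[of Inv, OF body test this]
        show "halts_in (Loop num_vars (Seq (comp_cmd process_top) (comp_var_exp stack_size))) s''
          (tree_size n {} * (poly (cmd_time process_top) n + poly (exp_time stack_size) n + 1) + 1)
          (\<lambda>s. out s = concat (map encode_set (level n)))"
          by (rule halts_in_mono) (auto simp: Inv_def agree_def pending_def work_eq_0)
      qed
    qed
  qed
qed

end

text \<open>The program \<open>mis_prog\<close> is the same for all \<open>l\<close>; only the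
  polynomial varies.\<close>

theorem corollary4:
  fixes l :: nat
  shows "\<exists>(c :: prog) (p :: nat poly). \<forall>(n :: nat) (E :: nat set set).
    kl_graph 1 l {..<n} E \<longrightarrow>
      (\<exists>t Is.
        distinct Is \<and> set Is = {I. maximal_indep {..<n} E I} \<and>
        runs c (graph_input n E) t (concat (map encode_set Is)) \<and>
        t \<le> poly p n)"
proof (rule exI, rule exI, intro allI impI)
  \<comment> \<open>\<open>[:1, 1:]\<close> evaluates to \<open>n + 1\<close>, so its power bounds
    the tree size; the rest copies the bound of \<open>mis_prog_halts\<close>.\<close>
  let ?p = "1 + (cmd_time push_root + (exp_time stack_size +
    ([:1, 1:] ^ Suc l * (cmd_time process_top + exp_time stack_size + 1) + 1)))"
  fix n :: nat and E :: "nat set set"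
  assume G: "kl_graph 1 l {..<n} E"
  then interpret fin_graph n E
    by unfold_locales (simp add: kl_graph_def simple_graph_def)
  from G obtain S K where part: "kl_partition 1 l {..<n} E S K"
    by (auto simp: kl_graph_def)
  obtain t s where run: "steps mis_prog (start_state (graph_input n E)) t s"
    "out s = concat (map encode_set (level n))"
    and t: "t \<le> 1 + (poly (cmd_time push_root) n + (poly (exp_time stack_size) n +
      (tree_size n {} * (poly (cmd_time process_top) n + poly (exp_time stack_size) n + 1) + 1)))"
    using mis_prog_halts by (auto simp: halts_in_def)
  have "tree_size n {} * (poly (cmd_time process_top) n + poly (exp_time stack_size) n + 1)
    \<le> (n + 1) ^ Suc l * (poly (cmd_time process_top) n + poly (exp_time stack_size) n + 1)"
    by (intro mult_le_mono1 tree_size_root_le[OF part])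
  with t have "t \<le> poly ?p n"
    by (simp only: poly_add poly_mult poly_power poly_1 poly_pCons poly_0) simp
  moreover have "set (level n) = {I. maximal_indep {..<n} E I}" "distinct (level n)"
    using level_correct[of n] by (simp_all add: maximal_indep_iff)
  ultimately show "\<exists>t Is. distinct Is \<and> set Is = {I. maximal_indep {..<n} E I} \<and>
      runs mis_prog (graph_input n E) t (concat (map encode_set Is)) \<and> t \<le> poly ?p n"
    using run unfolding runs_def by blast
qed

end
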